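(* Let $\alpha>0$ and $k\in\mathbb{N}$, $k\ge1$. Suppose that $b=(b_n)_{n\in\mathbb{Z}}\in\ell^2$ and that $X=(x_j:j\in\mathbb{Z})$ is a complete interpolating sequence. Then there exists a function $I[b]$ on $\mathbb{R}$ which is a solution of $$(D^2-\alpha^2)^k I[b]=0\quad\text{on }\mathbb{R}\setminus X$$ and satisfies (1) $I[b]\in(C_0^{2k-2}\cap L_2)(\mathbb{R})$; (2) $I[b](x_n)=b_n$ for all $n\in\mathbb{Z}$.
   Context: $D=d/dx$. A sequence of real numbers $X=(x_j:j\in\mathbb{Z})$ is a complete interpolating sequence if $(e^{ix_j\,\cdot}:j\in\mathbb{Z})$ is a Riesz basis for $L_2([-\pi,\pi])$. $C_0(\mathbb{R})$ denotes the continuous functions on $\mathbb{R}$ vanishing at infinity, and $C_0^{2k-2}(\mathbb{R})$ the $(2k-2)$-times continuously differentiable functions on $\mathbb{R}$ whose derivatives of orders $0,\dots,2k-2$ all lie in $C_0(\mathbb{R})$. *)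

theory Defs
  imports "HOL-Analysis.Analysis"
begin

definition l2_seq :: "('i \<Rightarrow> complex) \<Rightarrow> bool" where
  "l2_seq b \<longleftrightarrow> (\<lambda>n. (norm (b n))\<^sup>2) summable_on UNIV"

text \<open>Functions are not identified up to null sets; \<open>L2_norm\<close> is thus a seminorm on \<open>L2_fun M\<close>.\<close>

definition L2_fun :: "'a measure \<Rightarrow> ('a \<Rightarrow> complex) set" where
  "L2_fun M = {f \<in> borel_measurable M. integrable M (\<lambda>t. (norm (f t))\<^sup>2)}"

definition L2_norm :: "'a measure \<Rightarrow> ('a \<Rightarrow> complex) \<Rightarrow> real" where
  "L2_norm M f = sqrt (\<integral>t. (norm (f t))\<^sup>2 \<partial>M)"

text \<open>A Riesz basis of \<open>L\<^sub>2(M)\<close>: a Riesz sequence (two-sided \<open>\<ell>\<^sup>2\<close> bound on finite linear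
  combinations) whose linear span is dense.\<close>

definition Riesz_basis_L2 :: "'a measure \<Rightarrow> ('i \<Rightarrow> 'a \<Rightarrow> complex) \<Rightarrow> bool" where
  "Riesz_basis_L2 M f \<longleftrightarrow>
     (\<forall>j. f j \<in> L2_fun M) \<and>
     (\<exists>A B. 0 < A \<and> 0 < B \<and>
        (\<forall>J c. finite J \<longrightarrow>
           A * (\<Sum>j\<in>J. (norm (c j))\<^sup>2) \<le> (L2_norm M (\<lambda>t. \<Sum>j\<in>J. c j * f j t))\<^sup>2 \<and>
           (L2_norm M (\<lambda>t. \<Sum>j\<in>J. c j * f j t))\<^sup>2 \<le> B * (\<Sum>j\<in>J. (norm (c j))\<^sup>2))) \<and>
     (\<forall>h \<in> L2_fun M. \<forall>\<epsilon>>0. \<exists>J c. finite J \<and>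
        L2_norm M (\<lambda>t. h t - (\<Sum>j\<in>J. c j * f j t)) < \<epsilon>)"

definition complete_interpolating_sequence :: "(int \<Rightarrow> real) \<Rightarrow> bool" where
  "complete_interpolating_sequence x \<longleftrightarrow>
     Riesz_basis_L2 (lebesgue_on {-pi..pi}) (\<lambda>j t. exp (\<i> * of_real (x j * t)))"

definition D :: "(real \<Rightarrow> complex) \<Rightarrow> real \<Rightarrow> complex" where
  "D u = (\<lambda>t. vector_derivative u (at t))"

text \<open>Since \<open>D\<close> is total, differentiability has to be required separately; on open \<open>S\<close> the
  following is \<open>n\<close>-fold differentiability.\<close>

definition times_differentiable_on :: "nat \<Rightarrow> (real \<Rightarrow> complex) \<Rightarrow> real set \<Rightarrow> bool" where
  "times_differentiable_on n u S \<longleftrightarrow> (\<forall>m<n. \<forall>t\<in>S. (D ^^ m) u differentiable (at t))"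

definition C0 :: "(real \<Rightarrow> complex) set" where
  "C0 = {u. continuous_on UNIV u \<and> (u \<longlongrightarrow> 0) at_infinity}"

definition C0_diff :: "nat \<Rightarrow> (real \<Rightarrow> complex) set" where
  "C0_diff m = {u. times_differentiable_on m u UNIV \<and> (\<forall>j\<le>m. (D ^^ j) u \<in> C0)}"

definition D2_minus :: "real \<Rightarrow> (real \<Rightarrow> complex) \<Rightarrow> real \<Rightarrow> complex" where
  "D2_minus \<alpha> u = (\<lambda>t. (D ^^ 2) u t - of_real (\<alpha>\<^sup>2) * u t)"

text \<open>Classical solutions of \<open>(D\<^sup>2 - \<alpha>\<^sup>2)\<^sup>k u = 0\<close> on \<open>S\<close>.  For open \<open>S\<close>, the values of
  \<open>u\<close> and its derivatives off \<open>S\<close> are irrelevant, as \<open>D\<close> is local.\<close>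

definition is_solution_on :: "real \<Rightarrow> nat \<Rightarrow> (real \<Rightarrow> complex) \<Rightarrow> real set \<Rightarrow> bool" where
  "is_solution_on \<alpha> k u S \<longleftrightarrow>
     times_differentiable_on (2 * k) u S \<and> (\<forall>t\<in>S. (D2_minus \<alpha> ^^ k) u t = 0)"

end

theory Submission
  imports Defs "HOL-Probability.Sinc_Integral"
begin

text \<open>
  Let \<open>\<phi>\<close> be the Fourier transform of \<open>(\<xi>\<^sup>2 + \<alpha>\<^sup>2) ^ (- k)\<close>, i.e. a multiple of the fundamental
  solution of \<open>(D\<^sup>2 - \<alpha>\<^sup>2)\<^sup>k\<close>, and look for \<open>I = (\<Sum>j. c j * \<phi>(t - x j))\<close>. The interpolation
  conditions say that the matrix \<open>\<phi>(x i - x j)\<close> maps \<open>c\<close> to \<open>b\<close>. Its quadratic form is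
  \<open>\<integral> \<bar>\<Sum>j. c j * exp (- \<i> * x j * \<xi>)\<bar>\<^sup>2 * (\<xi>\<^sup>2 + \<alpha>\<^sup>2) ^ (- k) d\<xi>\<close>, which is at least the integral over
  \<open>[-\<pi>, \<pi>]\<close>, so the lower Riesz bound makes the matrix coercive on \<open>\<ell>\<^sup>2\<close>. The upper bound is
  Schur's test: \<open>\<phi>\<close> decays exponentially, and the lower Riesz bound for two exponentials
  shows that the nodes are uniformly separated. Hence the matrix is invertible on \<open>\<ell>\<^sup>2\<close>.
\<close>

section \<open>Coercive matrices on square-summable sequences\<close>

text \<open>Differentiation under the integral reaches only order \<open>2 * k - 2\<close>; beyond
  that the symbol is no longer absolutely integrable. This is the smoothness claimed on the whole
  line, but the differential equation needs order \<open>2 * k\<close> off the nodes. The way round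
  is the identity \<open>(\<i> * \<xi>)^2 * w = a^2 * w - 1\<close> for
  \<open>w = 1 / (\<xi>^2 + a^2)\<close>, where \<open>a\<close> is \<alpha>: it says that
  \<open>D^2 - a^2\<close> turns the transform of \<open>w ^ (k + 1)\<close> into minus that of
  \<open>w ^ k\<close>. The equation thus descends to \<open>k = 1\<close>, whose kernel has a kink
  at the origin, and there the explicit form, a multiple of
  \<open>exp (- a * \<bar>t\<bar>)\<close>, is used. That form is obtained without contour
  integrals, from integration by parts in \<xi> and a growth argument; the same two relations give a
  recursion in \<open>k\<close> that carries the decay from \<open>k = 1\<close> and
  \<open>k = 2\<close> to all larger exponents.

  On the side of the matrix, coercivity becomes an explicit inverse: for a small step size
  \<open>tau\<close> the identity minus \<open>tau\<close> times the matrix is a contraction, so a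
  Neumann series solves the system.\<close>

lemma weighted_Cauchy_Schwarz:
  fixes a d :: "nat \<Rightarrow> real"
  assumes "\<And>j. 0 \<le> a j" "\<And>j. 0 \<le> d j" "summable a" "summable (\<lambda>j. a j * (d j)\<^sup>2)"
  shows "summable (\<lambda>j. a j * d j)"
    and "(\<Sum>j. a j * d j)\<^sup>2 \<le> (\<Sum>j. a j) * (\<Sum>j. a j * (d j)\<^sup>2)"
proof -
  show s: "summable (\<lambda>j. a j * d j)"
  proof (rule summable_comparison_test)
    show "\<exists>N. \<forall>n\<ge>N. norm (a n * d n) \<le> a n + a n * (d n)\<^sup>2"
    proof (intro exI allI impI)
      fix n
      have "d n \<le> 1 + (d n)\<^sup>2"
        using zero_le_power2[of "d n - 1/2"] by (simp add: power2_eq_square algebra_simps)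
      then have "a n * d n \<le> a n * (1 + (d n)\<^sup>2)"
        by (intro mult_left_mono assms)
      then show "norm (a n * d n) \<le> a n + a n * (d n)\<^sup>2"
        using assms(1,2)[of n] by (simp add: algebra_simps)
    qed
    show "summable (\<lambda>n. a n + a n * (d n)\<^sup>2)"
      by (intro summable_add assms)
  qed
  have fin: "(\<Sum>j<N. a j * d j)\<^sup>2 \<le> (\<Sum>j<N. a j) * (\<Sum>j<N. a j * (d j)\<^sup>2)" for N
  proof -
    \<comment> \<open>One root of the weight goes into each factor of the ordinary
      inequality.\<close>
    have eq: "sqrt (a j) * (sqrt (a j) * d j) = a j * d j" for j
      using assms(1)[of j] by (simp add: mult.assoc[symmetric])
    show ?thesis
      using Cauchy_Schwarz_ineq_sum[of "\<lambda>j. sqrt (a j)" "\<lambda>j. sqrt (a j) * d j" "{..<N}"]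
      by (simp add: eq power_mult_distrib assms(1))
  qed
  show "(\<Sum>j. a j * d j)\<^sup>2 \<le> (\<Sum>j. a j) * (\<Sum>j. a j * (d j)\<^sup>2)"
    by (rule LIMSEQ_le[OF tendsto_power[OF summable_LIMSEQ[OF s]]
          tendsto_mult[OF summable_LIMSEQ[OF assms(3)] summable_LIMSEQ[OF assms(4)]]])
       (use fin in auto)
qed

text \<open>Schur's test for a single row: \<open>u\<close> is a row of the matrix, or of values of
  a translated kernel, and \<open>d\<close> is the vector of coefficients.\<close>

lemma weighted_Cauchy_Schwarz_norm:
  fixes u d :: "nat \<Rightarrow> complex"
  assumes "summable (\<lambda>j. norm (u j))" "summable (\<lambda>j. norm (u j) * (norm (d j))\<^sup>2)"
  shows "summable (\<lambda>j. norm (u j * d j))"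
    and "(norm (\<Sum>j. u j * d j))\<^sup>2 \<le> (\<Sum>j. norm (u j)) * (\<Sum>j. norm (u j) * (norm (d j))\<^sup>2)"
proof -
  note W = weighted_Cauchy_Schwarz[of "\<lambda>j. norm (u j)" "\<lambda>j. norm (d j)", OF _ _ assms, simplified]
  show s: "summable (\<lambda>j. norm (u j * d j))"
    using W(1) by (simp add: norm_mult)
  have "norm (\<Sum>j. u j * d j) \<le> (\<Sum>j. norm (u j) * norm (d j))"
    using summable_norm[OF s] by (simp add: norm_mult)
  then have "(norm (\<Sum>j. u j * d j))\<^sup>2 \<le> (\<Sum>j. norm (u j) * norm (d j))\<^sup>2"
    by (rule power_mono) simp
  then show "(norm (\<Sum>j. u j * d j))\<^sup>2 \<le> (\<Sum>j. norm (u j)) * (\<Sum>j. norm (u j) * (norm (d j))\<^sup>2)"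
    using W(2) by linarith
qed

lemma summable_bounded_mult:
  fixes a d :: "nat \<Rightarrow> real"
  assumes "\<And>j. 0 \<le> a j" "\<And>j. a j \<le> C" "\<And>j. 0 \<le> d j" "summable d"
  shows "summable (\<lambda>j. a j * d j)"
proof (rule summable_comparison_test)
  show "\<exists>N. \<forall>j\<ge>N. norm (a j * d j) \<le> C * d j"
    using assms(1-3) by (simp add: abs_mult mult_right_mono)
  show "summable (\<lambda>j. C * d j)"
    by (rule summable_mult[OF assms(4)])
qed

lemma summable_partial_sums_bounded:
  fixes f :: "nat \<Rightarrow> real"
  assumes "\<And>i. 0 \<le> f i" "\<And>N. (\<Sum>i<N. f i) \<le> C"
  shows "summable f" "(\<Sum>i. f i) \<le> C"
proof -
  show "summable f"
    by (rule summableI_nonneg_bounded[OF assms])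
  then show "(\<Sum>i. f i) \<le> C"
    by (rule suminf_le_const) (rule assms)
qed

text \<open>All assumptions are about finite sections, where they can be checked directly for the
  kernel matrix; the passage to square-summable sequences happens inside the locale. By Schur's test
  \<open>L\<close> bounds the operator norm.\<close>

locale coercive_matrix =
  fixes K :: "nat \<Rightarrow> nat \<Rightarrow> complex" and L m :: real
  assumes row: "\<And>i N. (\<Sum>j<N. norm (K i j)) \<le> L"
    and col: "\<And>j N. (\<Sum>i<N. norm (K i j)) \<le> L"
    and m_pos: "m > 0"
    and coercive: "\<And>c N. m * (\<Sum>i<N. (norm (c i))\<^sup>2) \<le> Re (\<Sum>i<N. \<Sum>j<N. cnj (c i) * K i j * c j)"
begin

definition sq :: "(nat \<Rightarrow> complex) \<Rightarrow> real" where
  "sq d = (\<Sum>i. (norm (d i))\<^sup>2)"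

definition l2 :: "(nat \<Rightarrow> complex) \<Rightarrow> bool" where
  "l2 d \<longleftrightarrow> summable (\<lambda>i. (norm (d i))\<^sup>2)"

definition app :: "(nat \<Rightarrow> complex) \<Rightarrow> nat \<Rightarrow> complex" where
  "app d i = (\<Sum>j. K i j * d j)"

text \<open>Testing with the first unit vector puts the corner entry between the coercivity constant
  and the row bound. This yields positivity of \<open>L\<close> and later of
  \<open>q\<close>.\<close>

lemma m_le_L: "m \<le> L"
proof -
  have "m \<le> Re (K 0 0)"
    using coercive[where N=1 and c="\<lambda>_. 1"] by simp
  also have "\<dots> \<le> norm (K 0 0)"
    by (rule complex_Re_le_cmod)
  also have "\<dots> \<le> L"
    using row[where N=1 and i=0] by simp
  finally show ?thesis .
qed

lemma L_pos: "L > 0"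
  using m_le_L m_pos by linarith

lemma K_le: "norm (K i j) \<le> L"
proof -
  have "norm (K i j) \<le> (\<Sum>j<Suc j. norm (K i j))"
    by (rule member_le_sum) auto
  with row show ?thesis
    using order_trans by blast
qed

lemma summable_row: "summable (\<lambda>j. norm (K i j))"
  and suminf_row: "(\<Sum>j. norm (K i j)) \<le> L"
  by (rule summable_partial_sums_bounded[OF norm_ge_zero row])+

lemma sq_nonneg: "l2 d \<Longrightarrow> 0 \<le> sq d"
  unfolding sq_def l2_def by (rule suminf_nonneg) auto

lemma l2_partial: "l2 d \<Longrightarrow> (\<Sum>i<N. (norm (d i))\<^sup>2) \<le> sq d"
  unfolding sq_def l2_def by (rule sum_le_suminf) auto

lemma l2_component: "l2 d \<Longrightarrow> norm (d i) \<le> sqrt (sq d)"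
proof -
  assume d: "l2 d"
  have "(norm (d i))\<^sup>2 \<le> (\<Sum>i<Suc i. (norm (d i))\<^sup>2)"
    by (rule member_le_sum) auto
  with l2_partial[OF d] have "(norm (d i))\<^sup>2 \<le> sq d"
    using order_trans by blast
  then show ?thesis
    by (rule real_le_rsqrt)
qed

lemma summable_weighted: "l2 d \<Longrightarrow> summable (\<lambda>j. norm (K i j) * (norm (d j))\<^sup>2)"
  unfolding l2_def by (rule summable_bounded_mult[where C=L]) (auto simp: K_le)

lemma summable_app_norm: "l2 d \<Longrightarrow> summable (\<lambda>j. norm (K i j * d j))"
  by (rule weighted_Cauchy_Schwarz_norm(1)[OF summable_row summable_weighted])

lemma app_sums: "l2 d \<Longrightarrow> (\<lambda>j. K i j * d j) sums app d i"
  unfolding app_def by (rule summable_sums[OF summable_norm_cancel[OF summable_app_norm]])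

text \<open>Schur's test: Cauchy-Schwarz in each row costs one factor \<open>L\<close> for the row
  sum; exchanging the sums then leaves column sums, which cost the second.\<close>

lemma app_partial:
  assumes "l2 d"
  shows "(\<Sum>i<N. (norm (app d i))\<^sup>2) \<le> L\<^sup>2 * sq d"
proof -
  have "(\<Sum>i<N. (norm (app d i))\<^sup>2) \<le> (\<Sum>i<N. L * (\<Sum>j. norm (K i j) * (norm (d j))\<^sup>2))"
  proof (rule sum_mono)
    fix i
    have "(norm (app d i))\<^sup>2 \<le> (\<Sum>j. norm (K i j)) * (\<Sum>j. norm (K i j) * (norm (d j))\<^sup>2)"
      unfolding app_def
      by (rule weighted_Cauchy_Schwarz_norm(2)[OF summable_row summable_weighted[OF assms]])
    also have "\<dots> \<le> L * (\<Sum>j. norm (K i j) * (norm (d j))\<^sup>2)"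
      by (intro mult_right_mono suminf_row suminf_nonneg summable_weighted assms) auto
    finally show "(norm (app d i))\<^sup>2 \<le> L * (\<Sum>j. norm (K i j) * (norm (d j))\<^sup>2)" .
  qed
  also have "\<dots> = L * (\<Sum>j. \<Sum>i<N. norm (K i j) * (norm (d j))\<^sup>2)"
    by (subst suminf_sum) (auto simp: sum_distrib_left summable_weighted[OF assms])
  also have "(\<Sum>j. \<Sum>i<N. norm (K i j) * (norm (d j))\<^sup>2) \<le> (\<Sum>j. L * (norm (d j))\<^sup>2)"
  proof (rule suminf_le)
    show "(\<Sum>i<N. norm (K i j) * (norm (d j))\<^sup>2) \<le> L * (norm (d j))\<^sup>2" for j
      by (simp add: sum_distrib_right[symmetric] mult_right_mono col)
    show "summable (\<lambda>j. \<Sum>i<N. norm (K i j) * (norm (d j))\<^sup>2)"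
      by (intro summable_sum summable_weighted assms)
    show "summable (\<lambda>j. L * (norm (d j))\<^sup>2)"
      using assms unfolding l2_def by (rule summable_mult)
  qed
  also have "\<dots> = L * sq d"
    using assms unfolding sq_def l2_def by (rule suminf_mult)
  finally show ?thesis
    using L_pos by (simp add: power2_eq_square mult.assoc)
qed

lemma app_l2: assumes "l2 d" shows "l2 (app d)" "sq (app d) \<le> L\<^sup>2 * sq d"
  unfolding l2_def sq_def[of "app d"]
  by (rule summable_partial_sums_bounded[OF zero_le_power2 app_partial[OF assms]])+

lemma summable_cnj_app:
  assumes "l2 d"
  shows "summable (\<lambda>i. Re (cnj (d i) * app d i))"
proof (rule summable_comparison_test)
  show "summable (\<lambda>i. (norm (d i))\<^sup>2 + (norm (app d i))\<^sup>2)"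
    using assms app_l2(1)[OF assms] unfolding l2_def by (rule summable_add)
  have "norm (Re (cnj z * w)) \<le> (norm z)\<^sup>2 + (norm w)\<^sup>2" for z w
  proof -
    have "norm (Re (cnj z * w)) \<le> norm z * norm w"
      using abs_Re_le_cmod[of "cnj z * w"] by (simp add: norm_mult)
    also have "\<dots> \<le> (norm z)\<^sup>2 + (norm w)\<^sup>2"
      using sum_squares_bound[of "norm z" "norm w"] zero_le_power2[of "norm z"] zero_le_power2[of "norm w"]
        mult_nonneg_nonneg[of "norm z" "norm w"] unfolding mult.assoc by linarith
    finally show ?thesis .
  qed
  then show "\<exists>N. \<forall>n\<ge>N. norm (Re (cnj (d n) * app d n)) \<le> (norm (d n))\<^sup>2 + (norm (app d n))\<^sup>2"
    by blast
qed

text \<open>Cutting both indices at \<open>N\<close> leaves the finite form plus the pairing of the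
  first \<open>N\<close> entries with the image of the tail \<open>v N\<close>. The second term is
  at most \<open>sqrt (sq d * (L^2 * sq (v N)))\<close> and vanishes in the limit.\<close>

lemma coercive_l2:
  assumes d: "l2 d"
  shows "m * sq d \<le> (\<Sum>i. Re (cnj (d i) * app d i))"
proof -
  define u where "u N j = (if j < N then d j else 0)" for N j
  define v where "v N j = (if j < N then 0 else d j)" for N j
  have v_l2: "l2 (v N)" for N
    using d unfolding l2_def v_def
    by (rule summable_comparison_test[rotated]) auto
  have sq_v: "sq (v N) = sq d - (\<Sum>j<N. (norm (d j))\<^sup>2)" for N
  proof -
    have "(\<lambda>j. (norm (d j))\<^sup>2 - (if j \<in> {..<N} then (norm (d j))\<^sup>2 else 0))
        sums (sq d - (\<Sum>j<N. (norm (d j))\<^sup>2))"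
      using d unfolding l2_def sq_def
      by (intro sums_diff summable_sums sums_If_finite_set) auto
    moreover have "(\<lambda>j. (norm (d j))\<^sup>2 - (if j \<in> {..<N} then (norm (d j))\<^sup>2 else 0)) = (\<lambda>j. (norm (v N j))\<^sup>2)"
      by (auto simp: v_def)
    ultimately show ?thesis
      unfolding sq_def by (simp add: sums_iff)
  qed
  have split: "app d i = (\<Sum>j<N. K i j * d j) + app (v N) i" for i N
  proof -
    have "(\<lambda>j. (if j \<in> {..<N} then K i j * d j else 0) + K i j * v N j)
        sums ((\<Sum>j<N. K i j * d j) + app (v N) i)"
      by (intro sums_add app_sums v_l2 sums_If_finite_set) auto
    moreover have "(\<lambda>j. (if j \<in> {..<N} then K i j * d j else 0) + K i j * v N j) = (\<lambda>j. K i j * d j)"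
      by (auto simp: v_def)
    ultimately show ?thesis
      unfolding app_def by (simp add: sums_iff)
  qed
  have lower: "m * (\<Sum>i<N. (norm (d i))\<^sup>2) - sqrt (sq d * (L\<^sup>2 * sq (v N)))
      \<le> (\<Sum>i<N. Re (cnj (d i) * app d i))" for N
  proof -
    have "\<bar>Re (\<Sum>i<N. cnj (d i) * app (v N) i)\<bar> \<le> (\<Sum>i<N. norm (d i) * norm (app (v N) i))"
      by (rule order_trans[OF abs_Re_le_cmod], rule sum_norm_le) (simp add: norm_mult)
    also have "\<dots> \<le> sqrt (sq d * (L\<^sup>2 * sq (v N)))"
    proof (rule real_le_rsqrt)
      have "(\<Sum>i<N. norm (d i) * norm (app (v N) i))\<^sup>2
          \<le> (\<Sum>i<N. (norm (d i))\<^sup>2) * (\<Sum>i<N. (norm (app (v N) i))\<^sup>2)"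
        by (rule Cauchy_Schwarz_ineq_sum)
      also have "\<dots> \<le> sq d * (L\<^sup>2 * sq (v N))"
        by (intro mult_mono l2_partial d app_partial v_l2 sq_nonneg sum_nonneg) auto
      finally show "(\<Sum>i<N. norm (d i) * norm (app (v N) i))\<^sup>2 \<le> sq d * (L\<^sup>2 * sq (v N))" .
    qed
    finally have err: "\<bar>Re (\<Sum>i<N. cnj (d i) * app (v N) i)\<bar> \<le> sqrt (sq d * (L\<^sup>2 * sq (v N)))" .
    have "(\<Sum>i<N. Re (cnj (d i) * app d i)) = Re (\<Sum>i<N. cnj (d i) * app d i)"
      by simp
    also have "(\<Sum>i<N. cnj (d i) * app d i)
        = (\<Sum>i<N. \<Sum>j<N. cnj (d i) * K i j * d j) + (\<Sum>i<N. cnj (d i) * app (v N) i)"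
      by (subst split[of _ N])
         (simp add: distrib_left sum.distrib sum_distrib_left mult.assoc)
    finally have "(\<Sum>i<N. Re (cnj (d i) * app d i))
        = Re (\<Sum>i<N. \<Sum>j<N. cnj (d i) * K i j * d j) + Re (\<Sum>i<N. cnj (d i) * app (v N) i)"
      by simp
    with err coercive[where N=N and c=d] show ?thesis
      by linarith
  qed
  have lim: "(\<lambda>N. \<Sum>i<N. (norm (d i))\<^sup>2) \<longlonglongrightarrow> sq d"
    using d unfolding l2_def sq_def by (rule summable_LIMSEQ)
  have "(\<lambda>N. m * (\<Sum>i<N. (norm (d i))\<^sup>2) - sqrt (sq d * (L\<^sup>2 * sq (v N))))
      \<longlonglongrightarrow> m * sq d - sqrt (sq d * (L\<^sup>2 * (sq d - sq d)))"
    unfolding sq_v by (intro tendsto_intros lim)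
  then have "(\<lambda>N. m * (\<Sum>i<N. (norm (d i))\<^sup>2) - sqrt (sq d * (L\<^sup>2 * sq (v N)))) \<longlonglongrightarrow> m * sq d"
    by simp
  then show ?thesis
    by (rule LIMSEQ_le[OF _ summable_LIMSEQ[OF summable_cnj_app[OF d]]]) (use lower in auto)
qed

section \<open>Inversion by a damped iteration\<close>

definition tau :: real where "tau = m / L\<^sup>2"
text \<open>The contraction factor for the optimal step size is \<open>1 - m^2 / L^2\<close>, which
  is \<open>0\<close> if \<open>m = L\<close>. Halving the subtracted term keeps \<open>q\<close>
  positive, so that powers of \<open>sqrt q\<close> can serve as divisors.\<close>

definition q :: real where "q = 1 - m\<^sup>2 / (2 * L\<^sup>2)"

lemma q: "0 < q" "q < 1"
proof -
  have "m\<^sup>2 \<le> L\<^sup>2"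
    using m_le_L m_pos by (simp add: power_mono)
  then have "m\<^sup>2 / (2 * L\<^sup>2) \<le> 1/2"
    using L_pos by (simp add: divide_simps)
  then show "0 < q"
    unfolding q_def by linarith
  show "q < 1"
    unfolding q_def using L_pos m_pos by simp
qed

lemma tau_pos: "tau > 0"
  unfolding tau_def using L_pos m_pos by simp

definition step :: "(nat \<Rightarrow> complex) \<Rightarrow> nat \<Rightarrow> complex" where
  "step d = (\<lambda>i. d i - of_real tau * app d i)"

text \<open>With step size \<open>t \<ge> 0\<close>, expanding the square and using coercivity and
  the norm bound gives the factor \<open>1 - 2 * t * m + t^2 * L^2\<close>. Its minimiser is
  \<open>tau\<close>.\<close>

lemma step_contraction:
  assumes d: "l2 d"
  shows "l2 (step d)" "sq (step d) \<le> q * sq d"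
proof -
  have expand: "(norm (z - of_real t * w))\<^sup>2 = (norm z)\<^sup>2 - 2 * t * Re (cnj z * w) + t\<^sup>2 * (norm w)\<^sup>2"
    for z w :: complex and t :: real
    unfolding cmod_power2 by (simp add: power2_eq_square algebra_simps)
  have S: "(\<lambda>i. (norm (step d i))\<^sup>2) sums
      (sq d - 2 * tau * (\<Sum>i. Re (cnj (d i) * app d i)) + tau\<^sup>2 * sq (app d))"
    unfolding step_def expand sq_def
    using d app_l2(1)[OF d] summable_cnj_app[OF d]
    by (intro sums_add sums_diff sums_mult summable_sums) (simp_all add: l2_def)
  then show "l2 (step d)"
    unfolding l2_def by (rule sums_summable)
  have "sq (step d) = sq d - 2 * tau * (\<Sum>i. Re (cnj (d i) * app d i)) + tau\<^sup>2 * sq (app d)"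
    using S unfolding sq_def by (simp add: sums_iff)
  also have "\<dots> \<le> sq d - 2 * tau * (m * sq d) + tau\<^sup>2 * (L\<^sup>2 * sq d)"
    using app_l2(2)[OF d] coercive_l2[OF d] tau_pos
    by (intro add_mono diff_mono mult_left_mono) auto
  also have "\<dots> = (1 - m\<^sup>2 / L\<^sup>2) * sq d"
    using L_pos by (simp add: tau_def field_simps power2_eq_square)
  also have "\<dots> \<le> q * sq d"
    using sq_nonneg[OF d] m_pos L_pos
    by (intro mult_right_mono) (auto simp: q_def field_simps)
  finally show "sq (step d) \<le> q * sq d" .
qed

lemma step_iterate:
  assumes "l2 d"
  shows "l2 ((step ^^ n) d)" "sq ((step ^^ n) d) \<le> q ^ n * sq d"
proof -
  have "l2 ((step ^^ n) d) \<and> sq ((step ^^ n) d) \<le> q ^ n * sq d"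
  proof (induction n)
    case (Suc n)
    have "sq ((step ^^ Suc n) d) \<le> q * sq ((step ^^ n) d)"
      using step_contraction[of "(step ^^ n) d"] Suc.IH by simp
    also have "\<dots> \<le> q * (q ^ n * sq d)"
      using Suc.IH q by (intro mult_left_mono) auto
    finally show ?case
      using Suc.IH step_contraction[of "(step ^^ n) d"] by simp
  qed (use assms in simp)
  then show "l2 ((step ^^ n) d)" "sq ((step ^^ n) d) \<le> q ^ n * sq d"
    by blast+
qed

text \<open>Since rows are absolutely summable, uniform smallness of the entries is enough to make
  each component of the image small. The limit in the Neumann series can therefore be taken
  component by component.\<close>

lemma app_sup_bound:
  assumes "l2 e" "\<And>j. norm (e j) \<le> B"
  shows "norm (app e i) \<le> L * B"
proof -
  have B: "0 \<le> B"
    using assms(2)[of 0] norm_ge_zero order_trans by blast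
  have "norm (app e i) \<le> (\<Sum>j. norm (K i j * e j))"
    unfolding app_def by (rule summable_norm[OF summable_app_norm[OF assms(1)]])
  also have "\<dots> \<le> (\<Sum>j. norm (K i j) * B)"
    by (intro suminf_le summable_app_norm assms summable_mult2 summable_row)
       (simp add: norm_mult assms mult_left_mono)
  also have "\<dots> = (\<Sum>j. norm (K i j)) * B"
    by (rule suminf_mult2[symmetric, OF summable_row])
  also have "\<dots> \<le> L * B"
    by (intro mult_right_mono suminf_row B)
  finally show ?thesis .
qed

lemma l2_add: "l2 u \<Longrightarrow> l2 v \<Longrightarrow> l2 (\<lambda>i. u i + v i)"
proof -
  assume uv: "l2 u" "l2 v"
  have "(norm (z + w))\<^sup>2 \<le> 2 * (norm z)\<^sup>2 + 2 * (norm w)\<^sup>2" for z w :: complex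
  proof -
    have "(norm (z + w))\<^sup>2 \<le> (norm z + norm w)\<^sup>2"
      by (intro power_mono norm_triangle_ineq) auto
    also have "\<dots> \<le> 2 * (norm z)\<^sup>2 + 2 * (norm w)\<^sup>2"
      using sum_squares_bound[of "norm z" "norm w"] by (simp add: power2_sum)
    finally show ?thesis .
  qed
  then have "\<exists>N. \<forall>i\<ge>N. norm ((norm (u i + v i))\<^sup>2) \<le> 2 * (norm (u i))\<^sup>2 + 2 * (norm (v i))\<^sup>2"
    by simp
  moreover have "summable (\<lambda>i. 2 * (norm (u i))\<^sup>2 + 2 * (norm (v i))\<^sup>2)"
    using uv unfolding l2_def by (intro summable_add summable_mult)
  ultimately show ?thesis
    unfolding l2_def by (rule summable_comparison_test)
qed

lemma l2_scale: "l2 u \<Longrightarrow> l2 (\<lambda>i. a * u i)"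
  unfolding l2_def norm_mult power_mult_distrib by (rule summable_mult)

lemma app_add: "l2 u \<Longrightarrow> l2 v \<Longrightarrow> app (\<lambda>i. u i + v i) i = app u i + app v i"
  using sums_add[OF app_sums app_sums, of u v i i] unfolding app_def
  by (simp add: sums_iff distrib_left)

lemma app_sum:
  fixes d :: "nat \<Rightarrow> nat \<Rightarrow> complex"
  assumes "\<And>n. l2 (d n)"
  shows "l2 (\<lambda>i. \<Sum>n<N. d n i) \<and> app (\<lambda>i. \<Sum>n<N. d n i) i = (\<Sum>n<N. app (d n) i)"
proof (induction N)
  case 0
  then show ?case by (simp add: l2_def app_def)
next
  case (Suc N)
  then show ?case by (simp add: l2_add app_add assms)
qed

text \<open>The solution is the Neumann series with terms \<open>(step ^^ n) (tau * b)\<close>. As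
  \<open>step\<close> is the identity minus \<open>tau\<close> times the matrix, \<open>tau\<close>
  times the image of a partial sum telescopes to \<open>d 0 - d N\<close>.\<close>

theorem solvable:
  assumes b: "l2 b"
  shows "\<exists>c. l2 c \<and> (\<forall>i. (\<lambda>j. K i j * c j) sums b i)"
proof -
  define d where "d n = (step ^^ n) (\<lambda>i. of_real tau * b i)" for n
  define B where "B = sq (\<lambda>i. of_real tau * b i)"
  \<comment> \<open>\<open>q\<close> contracts squared norms, so the entries themselves decay like
    powers of its square root.\<close>
  define r where "r = sqrt q"
  have r: "0 < r" "r < 1" "r\<^sup>2 = q"
    using q by (auto simp: r_def)
  have tb: "l2 (\<lambda>i. of_real tau * b i)"
    by (rule l2_scale[OF b])
  have B: "0 \<le> B"
    unfolding B_def by (rule sq_nonneg[OF tb])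
  have d_l2: "l2 (d n)" and d_sq: "sq (d n) \<le> q ^ n * B" for n
    unfolding d_def B_def by (rule step_iterate[OF tb])+
  have d_le: "norm (d n i) \<le> r ^ n * sqrt B" for n i
  proof -
    have "norm (d n i) \<le> sqrt (sq (d n))"
      by (rule l2_component[OF d_l2])
    also have "\<dots> \<le> sqrt (q ^ n * B)"
      by (intro real_sqrt_le_mono d_sq)
    finally show ?thesis
      by (simp add: real_sqrt_mult real_sqrt_power r_def)
  qed
  have sum_bd: "summable (\<lambda>n. r ^ n * sqrt B)"
    using r by (intro summable_mult2 summable_geometric) auto
  have sum_d_norm: "summable (\<lambda>n. norm (d n i))" for i
    by (rule summable_comparison_test[OF _ sum_bd]) (use d_le in auto)
  have sum_d: "summable (\<lambda>n. d n i)" for i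
    using sum_d_norm by (rule summable_norm_cancel)
  define c where "c i = (\<Sum>n. d n i)" for i
  \<comment> \<open>Weighted Cauchy-Schwarz with the weights \<open>r ^ n\<close>.\<close>
  have c_l2: "l2 c"
  proof -
    define a where "a n i = (norm (d n i))\<^sup>2 / r ^ n" for n i
    have a_eq: "r ^ n * (norm (d n i) / r ^ n)\<^sup>2 = a n i" for n i
      using r by (simp add: a_def power2_eq_square)
    have q_pow: "q ^ n / r ^ n = r ^ n" for n
      using r by (simp add: r(3)[symmetric] power2_eq_square power_mult_distrib)
    have a_le: "a n i \<le> r ^ n * B" for n i
    proof -
      have "(norm (d n i))\<^sup>2 \<le> (r ^ n * sqrt B)\<^sup>2"
        by (intro power_mono d_le) auto
      also have "\<dots> = r ^ n * B * r ^ n"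
        using B by (simp add: power2_eq_square)
      finally show ?thesis
        using r by (simp add: a_def divide_simps)
    qed
    have sum_rB: "summable (\<lambda>n. r ^ n * B)"
      using r by (intro summable_mult2 summable_geometric) auto
    have sum_a: "summable (\<lambda>n. a n i)" for i
      by (rule summable_comparison_test[OF _ sum_rB])
         (use a_le r in \<open>auto simp: a_def\<close>)
    have c_le: "(norm (c i))\<^sup>2 \<le> (1 / (1 - r)) * (\<Sum>n. a n i)" for i
    proof -
      have "(norm (c i))\<^sup>2 \<le> (\<Sum>n. norm (d n i))\<^sup>2"
        unfolding c_def by (intro power_mono summable_norm sum_d_norm) auto
      also have "\<dots> = (\<Sum>n. r ^ n * (norm (d n i) / r ^ n))\<^sup>2"
        using r by simp
      also have "\<dots> \<le> (\<Sum>n. r ^ n) * (\<Sum>n. r ^ n * (norm (d n i) / r ^ n)\<^sup>2)"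
        by (rule weighted_Cauchy_Schwarz(2))
           (use r sum_a[of i] in \<open>auto simp: a_eq summable_geometric\<close>)
      finally show ?thesis
        using r by (simp add: a_eq suminf_geometric)
    qed
    show ?thesis
      unfolding l2_def
    proof (rule summableI_nonneg_bounded)
      fix N
      have "(\<Sum>i<N. (norm (c i))\<^sup>2) \<le> (\<Sum>i<N. (1 / (1 - r)) * (\<Sum>n. a n i))"
        by (intro sum_mono c_le)
      also have "\<dots> = (1 / (1 - r)) * (\<Sum>n. \<Sum>i<N. a n i)"
        by (subst suminf_sum) (auto simp: sum_a sum_distrib_left)
      also have "\<dots> \<le> (1 / (1 - r)) * (\<Sum>n. r ^ n * B)"
      proof (intro mult_left_mono suminf_le summable_sum sum_a sum_rB)
        fix n
        have "(\<Sum>i<N. a n i) = (\<Sum>i<N. (norm (d n i))\<^sup>2) / r ^ n"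
          by (simp add: a_def sum_divide_distrib)
        also have "\<dots> \<le> q ^ n * B / r ^ n"
          using order_trans[OF l2_partial[OF d_l2] d_sq] r by (intro divide_right_mono) auto
        also have "\<dots> = r ^ n * B"
          using arg_cong[OF q_pow[of n], of "\<lambda>t. t * B"] by simp
        finally show "(\<Sum>i<N. a n i) \<le> r ^ n * B" .
      qed (use r in auto)
      finally show "(\<Sum>i<N. (norm (c i))\<^sup>2) \<le> (1 / (1 - r)) * (\<Sum>n. r ^ n * B)" .
    qed auto
  qed
  have "app c i = b i" for i
  proof -
    define s where "s N = (\<lambda>j. \<Sum>n<N. d n j)" for N
    have s: "l2 (s N)" "app (s N) i = (\<Sum>n<N. app (d n) i)" for N
      using app_sum[OF d_l2] by (simp_all add: s_def)
    have d_Suc: "d (Suc n) i = d n i - of_real tau * app (d n) i" for n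
      by (simp add: d_def step_def)
    have tele: "of_real tau * app (s N) i = d 0 i - d N i" for N
      unfolding s(2) by (induction N) (auto simp: distrib_left d_Suc)
    have err: "norm (app c i - app (s N) i) \<le> L * (\<Sum>n. r ^ (n + N) * sqrt B)" for N
    proof -
      have e_l2: "l2 (\<lambda>j. c j + (- 1) * s N j)"
        by (intro l2_add c_l2 l2_scale s)
      have "app c i = app (s N) i + app (\<lambda>j. c j + (- 1) * s N j) i"
        by (subst app_add[symmetric]) (use s(1) e_l2 in auto)
      moreover have "norm (app (\<lambda>j. c j + (- 1) * s N j) i) \<le> L * (\<Sum>n. r ^ (n + N) * sqrt B)"
      proof (rule app_sup_bound[OF e_l2])
        fix j
        have "c j + (- 1) * s N j = (\<Sum>n. d (n + N) j)"
          unfolding c_def s_def using suminf_minus_initial_segment[OF sum_d, of N j] by simp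
        also have "norm \<dots> \<le> (\<Sum>n. norm (d (n + N) j))"
          using sum_d_norm by (intro summable_norm) (simp add: summable_iff_shift[of "\<lambda>n. norm (d n j)"])
        also have "\<dots> \<le> (\<Sum>n. r ^ (n + N) * sqrt B)"
          using sum_d_norm[of j] sum_bd d_le
          by (intro suminf_le) (simp_all add: summable_iff_shift[of "\<lambda>n. norm (d n j)"]
                summable_iff_shift[of "\<lambda>n. r ^ n * sqrt B"])
        finally show "norm (c j + (- 1) * s N j) \<le> (\<Sum>n. r ^ (n + N) * sqrt B)" .
      qed
      ultimately show ?thesis by simp
    qed
    have "(\<lambda>N. \<Sum>n. r ^ (n + N) * sqrt B) \<longlonglongrightarrow> 0"
      by (rule suminf_exist_split2[OF sum_bd])
    then have "(\<lambda>N. L * (\<Sum>n. r ^ (n + N) * sqrt B)) \<longlonglongrightarrow> 0"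
      by (rule tendsto_mult_right_zero)
    then have "(\<lambda>N. app c i - app (s N) i) \<longlonglongrightarrow> 0"
      by (rule Lim_null_comparison[rotated]) (use err in auto)
    then have "(\<lambda>N. app c i - (app c i - app (s N) i)) \<longlonglongrightarrow> app c i - 0"
      by (intro tendsto_intros)
    then have "(\<lambda>N. of_real tau * app (s N) i) \<longlonglongrightarrow> of_real tau * app c i"
      by (intro tendsto_mult_left) simp
    moreover have "(\<lambda>N. d 0 i - d N i) \<longlonglongrightarrow> d 0 i - 0"
      by (intro tendsto_intros summable_LIMSEQ_zero sum_d)
    ultimately have "of_real tau * app c i = d 0 i"
      unfolding tele using LIMSEQ_unique by fastforce
    then show ?thesis
      using tau_pos by (simp add: d_def)
  qed
  then show ?thesis
    using c_l2 app_sums[OF c_l2] by metis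
qed

end

section \<open>The kernel\<close>

lemma norm_cis_diff_le: "norm (cis u - cis v) \<le> \<bar>u - v\<bar>"
proof -
  have "(norm (cis u - cis v))\<^sup>2 = 2 - 2 * cos (u - v)"
    using sin_cos_squared_add[of u] sin_cos_squared_add[of v]
    unfolding cmod_power2 by (simp add: cos_diff power2_eq_square algebra_simps)
  also have "cos (u - v) = 1 - 2 * (sin ((u - v) / 2))\<^sup>2"
    using cos_double_sin[of "(u - v) / 2"] by (simp only: mult_2 field_sum_of_halves)
  also have "2 - 2 * (1 - 2 * (sin ((u - v) / 2))\<^sup>2) = (2 * \<bar>sin ((u - v) / 2)\<bar>)\<^sup>2"
    by (simp add: power_mult_distrib)
  also have "\<dots> \<le> (2 * \<bar>(u - v) / 2\<bar>)\<^sup>2"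
    by (rule power_mono) (use abs_sin_x_le_abs_x[of "(u - v) / 2"] in auto)
  also have "\<dots> = \<bar>u - v\<bar>\<^sup>2"
    by simp
  finally show ?thesis
    by (rule power2_le_imp_le) auto
qed

lemma isCont_cis_mult: "isCont (\<lambda>\<xi>. cis (t * \<xi>)) \<xi>"
  by (rule has_derivative_continuous[OF has_derivative_cis[OF has_derivative_mult_right[OF has_derivative_ident]]])

lemma integrable_mult_cis:
  fixes g :: "real \<Rightarrow> complex"
  assumes "integrable lborel g"
  shows "integrable lborel (\<lambda>\<xi>. g \<xi> * cis (t * \<xi>))"
proof (rule Bochner_Integration.integrable_bound[OF assms])
  have [measurable]: "g \<in> borel_measurable lborel"
    using assms by auto
  have "(\<lambda>\<xi>. cis (t * \<xi>)) \<in> borel_measurable borel"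
    by (intro borel_measurable_continuous_onI continuous_intros)
  then show "(\<lambda>\<xi>. g \<xi> * cis (t * \<xi>)) \<in> borel_measurable lborel"
    by measurable
qed (simp add: norm_mult)

lemma norm_fourier_integral_le:
  fixes g :: "real \<Rightarrow> complex"
  assumes "integrable lborel g"
  shows "norm (\<integral>\<xi>. g \<xi> * cis (t * \<xi>) \<partial>lborel) \<le> (\<integral>\<xi>. norm (g \<xi>) \<partial>lborel)"
  by (rule order_trans[OF integral_norm_bound]) (simp add: norm_mult)

lemma continuous_fourier_integral:
  fixes g :: "real \<Rightarrow> complex"
  assumes "integrable lborel g"
  shows "isCont (\<lambda>t. \<integral>\<xi>. g \<xi> * cis (t * \<xi>) \<partial>lborel) t"
  unfolding continuous_at_sequentially
proof (intro allI impI)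
  fix y assume y: "y \<longlonglongrightarrow> t"
  show "((\<lambda>t. \<integral>\<xi>. g \<xi> * cis (t * \<xi>) \<partial>lborel) \<circ> y) \<longlonglongrightarrow> (\<integral>\<xi>. g \<xi> * cis (t * \<xi>) \<partial>lborel)"
    unfolding comp_def
  proof (rule integral_dominated_convergence[where w="\<lambda>\<xi>. norm (g \<xi>)"])
    show "AE \<xi> in lborel. (\<lambda>n. g \<xi> * cis (y n * \<xi>)) \<longlonglongrightarrow> g \<xi> * cis (t * \<xi>)"
      by (intro AE_I2 tendsto_intros y)
  qed (use assms integrable_mult_cis[OF assms] in \<open>auto simp: norm_mult\<close>)
qed

text \<open>Dominated convergence for the remainder of the difference quotient. The Lipschitz bound
  for \<open>cis\<close> gives the majorant \<open>2 * \<bar>\<xi>\<bar> * norm (g \<xi>)\<close>,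
  which is where integrability of one more power of \<xi> enters.\<close>

lemma has_vector_derivative_fourier_integral:
  fixes g :: "real \<Rightarrow> complex"
  assumes g: "integrable lborel g" and g': "integrable lborel (\<lambda>\<xi>. \<i> * of_real \<xi> * g \<xi>)"
  shows "((\<lambda>t. \<integral>\<xi>. g \<xi> * cis (t * \<xi>) \<partial>lborel) has_vector_derivative
    (\<integral>\<xi>. \<i> * of_real \<xi> * g \<xi> * cis (t * \<xi>) \<partial>lborel)) (at t)"
proof -
  let ?f = "\<lambda>t. \<integral>\<xi>. g \<xi> * cis (t * \<xi>) \<partial>lborel"
  let ?f' = "\<integral>\<xi>. \<i> * of_real \<xi> * g \<xi> * cis (t * \<xi>) \<partial>lborel"
  define r where "r y \<xi> = (cis (y * \<xi>) - cis (t * \<xi>) - (y - t) *\<^sub>R (\<i> * of_real \<xi> * cis (t * \<xi>))) /\<^sub>R norm (y - t)"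
    for y \<xi>
  have r_lim: "((\<lambda>y. r y \<xi>) \<longlongrightarrow> 0) (at t)" for \<xi>
  proof -
    have "((\<lambda>y. cis (y * \<xi>)) has_derivative (\<lambda>h. (h * \<xi>) *\<^sub>R (\<i> * cis (t * \<xi>)))) (at t)"
      by (auto intro!: derivative_eq_intros)
    moreover have "norm (r y \<xi>) = norm (cis (y * \<xi>) - cis (t * \<xi>) - ((y - t) * \<xi>) *\<^sub>R (\<i> * cis (t * \<xi>))) / norm (y - t)" for y
      unfolding r_def norm_scaleR by (simp add: scaleR_conv_of_real mult_ac divide_inverse)
    ultimately have "((\<lambda>y. norm (r y \<xi>)) \<longlongrightarrow> 0) (at t)"
      by (simp only: has_derivative_iff_norm)
    then show ?thesis
      by (simp add: tendsto_norm_zero_iff)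
  qed
  have r_bound: "norm (r y \<xi>) \<le> 2 * \<bar>\<xi>\<bar>" if "y \<noteq> t" for y \<xi>
  proof -
    have "norm (cis (y * \<xi>) - cis (t * \<xi>) - (y - t) *\<^sub>R (\<i> * of_real \<xi> * cis (t * \<xi>)))
        \<le> \<bar>y * \<xi> - t * \<xi>\<bar> + \<bar>y - t\<bar> * \<bar>\<xi>\<bar>"
      by (rule order_trans[OF norm_triangle_ineq4], intro add_mono norm_cis_diff_le)
         (simp add: norm_mult)
    also have "\<dots> = \<bar>y - t\<bar> * (2 * \<bar>\<xi>\<bar>)"
      by (simp add: left_diff_distrib[symmetric] abs_mult)
    finally show ?thesis
      using that unfolding r_def norm_scaleR by (simp add: divide_simps mult_ac flip: divide_inverse_commute)
  qed
  have g_meas [measurable]: "g \<in> borel_measurable lborel"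
    using g by auto
  have r_meas [measurable]: "r y \<in> borel_measurable borel" for y
    unfolding r_def by (intro borel_measurable_continuous_onI continuous_intros)
  have quotient: "(?f y - ?f t - (y - t) *\<^sub>R ?f') /\<^sub>R norm (y - t) = (\<integral>\<xi>. g \<xi> * r y \<xi> \<partial>lborel)" for y
  proof -
    have "(\<integral>\<xi>. g \<xi> * r y \<xi> \<partial>lborel) = (\<integral>\<xi>. (g \<xi> * cis (y * \<xi>) - g \<xi> * cis (t * \<xi>)
        - (y - t) *\<^sub>R (\<i> * of_real \<xi> * g \<xi> * cis (t * \<xi>))) /\<^sub>R norm (y - t) \<partial>lborel)"
      unfolding r_def scaleR_conv_of_real
      by (rule Bochner_Integration.integral_cong[OF refl]) (simp only: algebra_simps)
    also have "\<dots> = (?f y - ?f t - (y - t) *\<^sub>R ?f') /\<^sub>R norm (y - t)"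
      using integrable_mult_cis[OF g] integrable_mult_cis[OF g'] by simp
    finally show ?thesis by simp
  qed
  have lim: "((\<lambda>y. \<integral>\<xi>. g \<xi> * r y \<xi> \<partial>lborel) \<longlongrightarrow> 0) (at t)"
    unfolding tendsto_at_iff_sequentially comp_def
  proof (intro allI impI)
    fix y :: "nat \<Rightarrow> real" assume y: "\<forall>i. y i \<in> UNIV - {t}" "y \<longlonglongrightarrow> t"
    have "(\<lambda>n. \<integral>\<xi>. g \<xi> * r (y n) \<xi> \<partial>lborel) \<longlonglongrightarrow> integral\<^sup>L lborel (\<lambda>\<xi>::real. 0)"
    proof (rule integral_dominated_convergence[where w="\<lambda>\<xi>. 2 * norm (\<i> * of_real \<xi> * g \<xi>)"])
      show "integrable lborel (\<lambda>\<xi>. 2 * norm (\<i> * of_real \<xi> * g \<xi>))"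
        by (intro integrable_mult_right integrable_norm g')
      have "(\<lambda>n. r (y n) \<xi>) \<longlonglongrightarrow> 0" for \<xi>
        using r_lim[of \<xi>] y unfolding tendsto_at_iff_sequentially comp_def by blast
      then have "(\<lambda>n. g \<xi> * r (y n) \<xi>) \<longlonglongrightarrow> 0" for \<xi>
        by (rule tendsto_mult_right_zero)
      then show "AE \<xi> in lborel. (\<lambda>n. g \<xi> * r (y n) \<xi>) \<longlonglongrightarrow> 0"
        by simp
      have "norm (g \<xi> * r (y n) \<xi>) \<le> 2 * norm (\<i> * of_real \<xi> * g \<xi>)" for n \<xi>
        using mult_left_mono[OF r_bound[of "y n" \<xi>], of "norm (g \<xi>)"] y(1)
        by (simp add: norm_mult mult_ac)
      then show "AE \<xi> in lborel. norm (g \<xi> * r (y n) \<xi>) \<le> 2 * norm (\<i> * of_real \<xi> * g \<xi>)" for n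
        by simp
    qed auto
    then show "(\<lambda>n. \<integral>\<xi>. g \<xi> * r (y n) \<xi> \<partial>lborel) \<longlonglongrightarrow> 0"
      by simp
  qed
  then have "((\<lambda>y. norm ((?f y - ?f t - (y - t) *\<^sub>R ?f') /\<^sub>R norm (y - t))) \<longlongrightarrow> 0) (at t)"
    unfolding quotient by (rule tendsto_norm_zero)
  then show ?thesis
    unfolding has_vector_derivative_def has_derivative_iff_norm
    by (simp add: bounded_linear_scaleR_left divide_inverse mult.commute)
qed

lemma has_vector_derivative_eq_on_pos:
  fixes f :: "real \<Rightarrow> 'a::real_normed_vector"
  assumes "(f has_vector_derivative f') (at t)" "0 < t" "\<And>s. 0 < s \<Longrightarrow> g s = f s"
  shows "(g has_vector_derivative f') (at t)"
  by (rule has_vector_derivative_transform_within_open[OF assms(1), of "{0<..}"])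
     (use assms(2,3) in auto)

section \<open>Decay faster than every power\<close>

definition rapid :: "(real \<Rightarrow> complex) \<Rightarrow> bool" where
  "rapid f \<longleftrightarrow> (\<forall>n. \<exists>C. \<forall>t. \<bar>t\<bar> ^ n * norm (f t) \<le> C)"

lemma rapid_add: "rapid f \<Longrightarrow> rapid g \<Longrightarrow> rapid (\<lambda>t. f t + g t)"
  unfolding rapid_def
proof
  fix n
  assume "\<forall>n. \<exists>C. \<forall>t. \<bar>t\<bar> ^ n * norm (f t) \<le> C" "\<forall>n. \<exists>C. \<forall>t. \<bar>t\<bar> ^ n * norm (g t) \<le> C"
  then obtain C C' where C: "\<And>t. \<bar>t\<bar> ^ n * norm (f t) \<le> C" "\<And>t. \<bar>t\<bar> ^ n * norm (g t) \<le> C'"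
    by metis
  have "\<bar>t\<bar> ^ n * norm (f t + g t) \<le> C + C'" for t
  proof -
    have "\<bar>t\<bar> ^ n * norm (f t + g t) \<le> \<bar>t\<bar> ^ n * (norm (f t) + norm (g t))"
      by (intro mult_left_mono norm_triangle_ineq) auto
    then show ?thesis
      using C[of t] by (simp add: distrib_left)
  qed
  then show "\<exists>C. \<forall>t. \<bar>t\<bar> ^ n * norm (f t + g t) \<le> C"
    by blast
qed

lemma rapid_scale: "rapid f \<Longrightarrow> rapid (\<lambda>t. c * f t)"
  unfolding rapid_def
proof
  fix n
  assume "\<forall>n. \<exists>C. \<forall>t. \<bar>t\<bar> ^ n * norm (f t) \<le> C"
  then obtain C where C: "\<And>t. \<bar>t\<bar> ^ n * norm (f t) \<le> C"
    by metis
  have "\<bar>t\<bar> ^ n * norm (c * f t) \<le> norm c * C" for t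
    using mult_left_mono[OF C[of t], of "norm c"] by (simp add: norm_mult mult_ac)
  then show "\<exists>C. \<forall>t. \<bar>t\<bar> ^ n * norm (c * f t) \<le> C"
    by blast
qed

text \<open>The factor \<open>t\<close> is absorbed by raising the exponent by one. This closure
  property is the reason for asking for decay beyond every power: each step of the recursion in
  \<open>k\<close> brings in factors of \<open>t\<close>.\<close>

lemma rapid_times: "rapid f \<Longrightarrow> rapid (\<lambda>t. of_real t * f t)"
  unfolding rapid_def
proof
  fix n
  assume "\<forall>n. \<exists>C. \<forall>t. \<bar>t\<bar> ^ n * norm (f t) \<le> C"
  then obtain C where C: "\<And>t. \<bar>t\<bar> ^ Suc n * norm (f t) \<le> C"
    by metis
  then show "\<exists>C. \<forall>t. \<bar>t\<bar> ^ n * norm (of_real t * f t) \<le> C"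
    by (intro exI[of _ C]) (simp add: norm_mult mult_ac)
qed

text \<open>A single value cannot spoil the bounds. The origin is exempted because some closed forms
  for the kernels are derived only away from it.\<close>

lemma rapid_dominated:
  assumes "rapid f" "\<And>t. t \<noteq> 0 \<Longrightarrow> norm (g t) \<le> norm (f t)"
  shows "rapid g"
  unfolding rapid_def
proof
  fix n
  obtain C where C: "\<And>t. \<bar>t\<bar> ^ n * norm (f t) \<le> C"
    using assms(1) unfolding rapid_def by metis
  have "\<bar>t\<bar> ^ n * norm (g t) \<le> max C (\<bar>0\<bar> ^ n * norm (g 0))" for t
  proof (cases "t = 0")
    case False
    then have "\<bar>t\<bar> ^ n * norm (g t) \<le> \<bar>t\<bar> ^ n * norm (f t)"
      by (intro mult_left_mono assms) auto
    with C[of t] show ?thesis by linarith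
  qed simp
  then show "\<exists>C. \<forall>t. \<bar>t\<bar> ^ n * norm (g t) \<le> C"
    by blast
qed

lemma rapid_exp:
  assumes "0 < a"
  shows "rapid (\<lambda>t. of_real (exp (- a * \<bar>t\<bar>)))"
  unfolding rapid_def
proof
  fix n
  have "\<bar>t\<bar> ^ n * norm (of_real (exp (- a * \<bar>t\<bar>)) :: complex) \<le> (real (Suc n) / a) ^ n" for t
  proof -
    \<comment> \<open>The estimate is \<open>u \<le> exp u\<close>, raised to the power
      \<open>n\<close>. Dividing by \<open>Suc n\<close> instead of \<open>n\<close> covers
      \<open>n = 0\<close> as well, and still \<open>n * u \<le> a * \<bar>t\<bar>\<close>.\<close>
    define u where "u = a * \<bar>t\<bar> / real (Suc n)"
    have "u \<le> exp u"
      using exp_ge_add_one_self[of u] by linarith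
    then have "\<bar>t\<bar> \<le> (real (Suc n) / a) * exp u"
      using assms by (simp add: u_def field_simps)
    then have "\<bar>t\<bar> ^ n \<le> ((real (Suc n) / a) * exp u) ^ n"
      by (intro power_mono) auto
    also have "\<dots> = (real (Suc n) / a) ^ n * exp (real n * u)"
      by (simp only: power_mult_distrib exp_of_nat_mult)
    also have "\<dots> \<le> (real (Suc n) / a) ^ n * exp (a * \<bar>t\<bar>)"
    proof (intro mult_left_mono)
      have "real n * u \<le> real (Suc n) * u"
        using assms by (intro mult_right_mono) (auto simp: u_def)
      then show "exp (real n * u) \<le> exp (a * \<bar>t\<bar>)"
        by (simp add: u_def)
    qed (use assms in auto)
    finally have "\<bar>t\<bar> ^ n * exp (- a * \<bar>t\<bar>) \<le> (real (Suc n) / a) ^ n * exp (a * \<bar>t\<bar>) * exp (- a * \<bar>t\<bar>)"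
      by (rule mult_right_mono) auto
    then show ?thesis
      unfolding norm_of_real by (simp add: mult.assoc exp_minus_inverse)
  qed
  then show "\<exists>C. \<forall>t. \<bar>t\<bar> ^ n * norm (of_real (exp (- a * \<bar>t\<bar>)) :: complex) \<le> C"
    by blast
qed

lemma rapid_bound:
  assumes "rapid f"
  obtains C where "0 \<le> C" "\<And>t. norm (f t) \<le> C / (1 + t\<^sup>2)"
proof -
  obtain A B where A: "\<And>t. \<bar>t\<bar> ^ 0 * norm (f t) \<le> A" and B: "\<And>t. \<bar>t\<bar> ^ 2 * norm (f t) \<le> B"
    using assms unfolding rapid_def by metis
  show ?thesis
  proof
    show "0 \<le> A + B"
      using A[of 0] B[of 0] norm_ge_zero[of "f 0"] by (simp del: norm_ge_zero)
    fix t
    have "(1 + t\<^sup>2) * norm (f t) \<le> A + B"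
      using A[of t] B[of t] by (simp add: distrib_right)
    moreover have "0 < 1 + t\<^sup>2"
      by (simp add: add_pos_nonneg)
    ultimately show "norm (f t) \<le> (A + B) / (1 + t\<^sup>2)"
      by (simp add: pos_le_divide_eq mult.commute)
  qed
qed

lemma constant_on_pos:
  fixes f :: "real \<Rightarrow> complex"
  assumes "\<And>t. 0 < t \<Longrightarrow> (f has_vector_derivative 0) (at t)"
  shows "\<exists>c. \<forall>t. 0 < t \<longrightarrow> f t = c"
proof -
  have "(f has_derivative (\<lambda>h. 0)) (at t within {0<..})" if "t \<in> {0<..}" for t
    using has_vector_derivative_at_within[OF assms] that by (simp add: has_vector_derivative_def)
  then have "\<exists>c. \<forall>t\<in>{0<..}. f t = c"
    by (intro has_derivative_zero_constant convex_real_interval)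
  then show ?thesis
    unfolding Ball_def greaterThan_iff .
qed

section \<open>Transforms of the powers of the symbol\<close>

locale symbol =
  fixes a :: real
  assumes a_pos: "0 < a"
begin

definition w :: "real \<Rightarrow> real" where "w \<xi> = 1 / (\<xi>\<^sup>2 + a\<^sup>2)"

definition wt :: "nat \<Rightarrow> nat \<Rightarrow> real \<Rightarrow> complex" where
  "wt m k \<xi> = (\<i> * of_real \<xi>) ^ m * of_real (w \<xi> ^ k)"

text \<open>\<open>M m k\<close> is the \<open>m\<close>-th derivative of the Fourier transform of \<open>w ^ k\<close>; the defining integral
  converges absolutely, and is meaningful, only for \<open>m + 2 \<le> 2 * k\<close>.\<close>

definition M :: "nat \<Rightarrow> nat \<Rightarrow> real \<Rightarrow> complex" where
  "M m k t = (\<integral>\<xi>. wt m k \<xi> * cis (t * \<xi>) \<partial>lborel)"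

lemma denom_pos: "0 < \<xi>\<^sup>2 + a\<^sup>2"
  using a_pos by (simp add: add_nonneg_pos)

lemma w_pos: "0 < w \<xi>"
  using denom_pos by (simp add: w_def)

lemma wt_continuous: "isCont (wt m k) \<xi>"
  unfolding wt_def w_def
  by (intro continuous_intros) (use denom_pos[of \<xi>] in auto)

lemma wt_measurable [measurable]: "wt m k \<in> borel_measurable borel"
  by (intro borel_measurable_continuous_onI continuous_at_imp_continuous_on ballI wt_continuous)

lemma integrable_w: "integrable lborel w"
proof (rule Bochner_Integration.integrable_bound)
  have "integrable lborel (\<lambda>x::real. inverse (1 + x\<^sup>2))"
    using integrable_inverse_1_plus_square by (simp add: set_integrable_def einterval_def)
  then show "integrable lborel (\<lambda>x::real. (1 + 1 / a\<^sup>2) * inverse (1 + x\<^sup>2))"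
    by (rule integrable_mult_right)
  show "w \<in> borel_measurable lborel"
    unfolding w_def by measurable
  have "norm (w \<xi>) \<le> norm ((1 + 1 / a\<^sup>2) * inverse (1 + \<xi>\<^sup>2))" for \<xi>
  proof -
    have "(1 + 1 / a\<^sup>2) * (\<xi>\<^sup>2 + a\<^sup>2) = (1 + \<xi>\<^sup>2) + (\<xi>\<^sup>2 / a\<^sup>2 + a\<^sup>2)"
      using a_pos by (simp add: field_simps)
    then have "1 + \<xi>\<^sup>2 \<le> (1 + 1 / a\<^sup>2) * (\<xi>\<^sup>2 + a\<^sup>2)"
      by (simp add: add_nonneg_nonneg)
    moreover have "0 < 1 + \<xi>\<^sup>2"
      by (simp add: add_pos_nonneg)
    moreover have "norm (w \<xi>) = 1 / (\<xi>\<^sup>2 + a\<^sup>2)"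
      "norm ((1 + 1 / a\<^sup>2) * inverse (1 + \<xi>\<^sup>2)) = (1 + 1 / a\<^sup>2) / (1 + \<xi>\<^sup>2)"
      using denom_pos[of \<xi>] by (auto simp: w_def divide_inverse abs_mult)
    ultimately show ?thesis
      using denom_pos[of \<xi>] by (simp add: divide_le_eq pos_le_divide_eq mult.commute)
  qed
  then show "AE \<xi> in lborel. norm (w \<xi>) \<le> norm ((1 + 1 / a\<^sup>2) * inverse (1 + \<xi>\<^sup>2))"
    by simp
qed

text \<open>One factor \<open>w\<close> is held back for integrability and the other
  \<open>k - 1\<close> factors absorb the power of \<xi>. The two summands of the constant come from
  \<open>\<bar>\<xi>\<bar> ^ m \<le> 1 + (\<xi>^2) ^ (k - 1)\<close>.\<close>

lemma norm_wt_le: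
  assumes "m + 2 \<le> 2 * k"
  shows "norm (wt m k \<xi>) \<le> ((1 / a\<^sup>2) ^ (k - 1) + 1) * w \<xi>"
proof -
  obtain n where k: "k = Suc n"
    using assms by (cases k) auto
  have m: "m \<le> 2 * n"
    using assms k by simp
  have "\<bar>\<xi>\<bar> ^ m \<le> 1 + (\<xi>\<^sup>2) ^ n"
  proof (cases "\<bar>\<xi>\<bar> \<le> 1")
    case True
    then have "\<bar>\<xi>\<bar> ^ m \<le> 1"
      by (intro power_le_one) auto
    moreover have "0 \<le> (\<xi>\<^sup>2) ^ n"
      by simp
    ultimately show ?thesis by linarith
  next
    case False
    then have "\<bar>\<xi>\<bar> ^ m \<le> \<bar>\<xi>\<bar> ^ (2 * n)"
      using m by (intro power_increasing) auto
    also have "\<dots> = (\<xi>\<^sup>2) ^ n"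
      by (simp add: power_mult)
    finally show ?thesis by simp
  qed
  then have "\<bar>\<xi>\<bar> ^ m * w \<xi> ^ n \<le> (1 + (\<xi>\<^sup>2) ^ n) * w \<xi> ^ n"
    using w_pos[of \<xi>] by (intro mult_right_mono) auto
  also have "\<dots> = w \<xi> ^ n + (\<xi>\<^sup>2 * w \<xi>) ^ n"
    by (simp add: distrib_right power_mult_distrib)
  also have "\<dots> \<le> (1 / a\<^sup>2) ^ n + 1 ^ n"
  proof (intro add_mono power_mono)
    show "w \<xi> \<le> 1 / a\<^sup>2"
      unfolding w_def using a_pos by (intro divide_left_mono) (auto intro!: mult_pos_pos add_nonneg_pos)
    show "\<xi>\<^sup>2 * w \<xi> \<le> 1"
      using denom_pos[of \<xi>] by (simp add: w_def)
  qed (use w_pos[of \<xi>] in auto)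
  finally have "\<bar>\<xi>\<bar> ^ m * w \<xi> ^ n * w \<xi> \<le> ((1 / a\<^sup>2) ^ n + 1) * w \<xi>"
    using w_pos[of \<xi>] by (intro mult_right_mono) auto
  moreover have "norm (wt m k \<xi>) = \<bar>\<xi>\<bar> ^ m * w \<xi> ^ n * w \<xi>"
    using w_pos[of \<xi>] by (simp add: wt_def k norm_mult norm_power abs_mult)
  ultimately show ?thesis
    by (simp add: k)
qed

lemma integrable_wt:
  assumes "m + 2 \<le> 2 * k"
  shows "integrable lborel (wt m k)"
proof (rule Bochner_Integration.integrable_bound)
  show "integrable lborel (\<lambda>\<xi>. ((1 / a\<^sup>2) ^ (k - 1) + 1) * w \<xi>)"
    by (intro integrable_mult_right integrable_w)
  show "AE \<xi> in lborel. norm (wt m k \<xi>) \<le> norm (((1 / a\<^sup>2) ^ (k - 1) + 1) * w \<xi>)"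
    unfolding real_norm_def by (intro AE_I2 order_trans[OF norm_wt_le[OF assms] abs_ge_self])
qed auto

lemma M_bounded:
  assumes "m + 2 \<le> 2 * k"
  shows "norm (M m k t) \<le> (\<integral>\<xi>. norm (wt m k \<xi>) \<partial>lborel)"
  unfolding M_def by (rule norm_fourier_integral_le[OF integrable_wt[OF assms]])

lemma M_continuous:
  assumes "m + 2 \<le> 2 * k"
  shows "isCont (M m k) t"
  unfolding M_def[abs_def] by (rule continuous_fourier_integral[OF integrable_wt[OF assms]])

lemma M_deriv:
  assumes "m + 3 \<le> 2 * k"
  shows "(M m k has_vector_derivative M (Suc m) k t) (at t)"
proof -
  have Suc: "wt (Suc m) k = (\<lambda>\<xi>. \<i> * of_real \<xi> * wt m k \<xi>)"
    by (simp add: wt_def fun_eq_iff)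
  show ?thesis
    unfolding M_def[abs_def] Suc
    by (intro has_vector_derivative_fourier_integral integrable_wt)
       (use assms integrable_wt[of "Suc m" k] in \<open>auto simp: Suc\<close>)
qed

text \<open>On the symbol this is \<open>(\<i> * \<xi>)^2 * w = a^2 * w - 1\<close>, that is,
  \<open>D^2 - a^2\<close> lowers the exponent by one and changes the sign. The assumption makes all
  three integrals absolutely convergent.\<close>

lemma M_reduce:
  assumes "m + 2 \<le> 2 * k"
  shows "M (m + 2) (Suc k) t = of_real (a\<^sup>2) * M m (Suc k) t - M m k t"
proof -
  have "wt (m + 2) (Suc k) \<xi> = of_real (a\<^sup>2) * wt m (Suc k) \<xi> - wt m k \<xi>" for \<xi>
  proof -
    have "- (\<xi>\<^sup>2) * w \<xi> = a\<^sup>2 * w \<xi> - 1"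
      unfolding w_def using less_imp_neq[OF denom_pos[of \<xi>]] by (simp add: divide_simps)
    then have "complex_of_real (- (\<xi>\<^sup>2) * w \<xi>) = of_real (a\<^sup>2 * w \<xi> - 1)"
      by (rule arg_cong)
    then have "(\<i> * of_real \<xi>)\<^sup>2 * of_real (w \<xi>) = of_real (a\<^sup>2) * of_real (w \<xi>) - (1::complex)"
      by (simp add: power_mult_distrib)
    then have "(\<i> * of_real \<xi>) ^ m * ((\<i> * of_real \<xi>)\<^sup>2 * of_real (w \<xi>)) * of_real (w \<xi> ^ k)
        = (\<i> * of_real \<xi>) ^ m * (of_real (a\<^sup>2) * of_real (w \<xi>) - 1) * (of_real (w \<xi> ^ k) :: complex)"
      by simp
    then show ?thesis
      unfolding wt_def power_add power_Suc of_real_mult by (simp only: algebra_simps mult_1)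
  qed
  then have "M (m + 2) (Suc k) t
      = (\<integral>\<xi>. of_real (a\<^sup>2) * (wt m (Suc k) \<xi> * cis (t * \<xi>)) - wt m k \<xi> * cis (t * \<xi>) \<partial>lborel)"
    unfolding M_def by (simp only: left_diff_distrib mult.assoc)
  also have "\<dots> = of_real (a\<^sup>2) * M m (Suc k) t - M m k t"
    using integrable_mult_cis[OF integrable_wt, of m "Suc k" t] integrable_mult_cis[OF integrable_wt, of m k t] assms
    unfolding M_def by simp
  finally show ?thesis .
qed

lemma w_tendsto_0: "(w \<longlongrightarrow> 0) at_top" "(w \<longlongrightarrow> 0) at_bot"
proof -
  have top: "filterlim (\<lambda>\<xi>. \<xi>\<^sup>2 + a\<^sup>2) at_top at_top"
    by (rule filterlim_at_top_mono[OF filterlim_pow_at_top[of 2 "\<lambda>x. x", OF _ filterlim_ident]]) auto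
  have bot: "filterlim (\<lambda>\<xi>. \<xi>\<^sup>2 + a\<^sup>2) at_top at_bot"
    using top unfolding at_bot_mirror filterlim_filtermap by simp
  show "(w \<longlongrightarrow> 0) at_top" "(w \<longlongrightarrow> 0) at_bot"
    unfolding w_def[abs_def] divide_inverse mult_1
    by (rule tendsto_inverse_0_at_top[OF top], rule tendsto_inverse_0_at_top[OF bot])
qed

text \<open>Integration by parts in \<open>\<xi>\<close>: the derivative of \<open>w ^ k\<close> is \<open>- 2 * k * \<xi> * w ^ (k + 1)\<close>.\<close>

lemma M_times:
  assumes "1 \<le> k"
  shows "of_real t * M 0 k t = - 2 * of_nat k * M 1 (Suc k) t"
proof -
  define f where "f \<xi> = \<i> * of_real t * (wt 0 k \<xi> * cis (t * \<xi>)) + 2 * of_nat k * \<i> * (wt 1 (Suc k) \<xi> * cis (t * \<xi>))" for \<xi>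
  define F where "F \<xi> = (w \<xi> ^ k) *\<^sub>R cis (t * \<xi>)" for \<xi>
  have int: "integrable lborel (\<lambda>\<xi>. wt 0 k \<xi> * cis (t * \<xi>))"
      "integrable lborel (\<lambda>\<xi>. wt 1 (Suc k) \<xi> * cis (t * \<xi>))"
    using assms by (auto intro!: integrable_mult_cis integrable_wt)
  have f_int: "integrable lborel f"
    unfolding f_def using int by (intro Bochner_Integration.integrable_add integrable_mult_right)
  have F_lim: "(F \<longlongrightarrow> 0) G" if "(w \<longlongrightarrow> 0) G" for G
  proof -
    have "((\<lambda>\<xi>. norm (F \<xi>)) \<longlongrightarrow> 0 ^ k) G"
      unfolding F_def using w_pos by (auto intro!: tendsto_intros that simp: less_imp_le)
    then show ?thesis
      using assms by (simp add: power_0_left tendsto_norm_zero_iff split: if_splits)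
  qed
  have "(LBINT \<xi>=-\<infinity>..\<infinity>. f \<xi>) = 0 - 0"
  proof (rule interval_integral_FTC_integrable)
    fix \<xi> :: real
    have w_deriv: "(w has_field_derivative (- 2 * \<xi> * (w \<xi>)\<^sup>2)) (at \<xi>)"
      unfolding w_def using denom_pos[of \<xi>]
      by (auto intro!: derivative_eq_intros simp: power2_eq_square divide_simps)
    have "((\<lambda>\<xi>. w \<xi> ^ k) has_field_derivative (of_nat k * (- 2 * \<xi> * (w \<xi>)\<^sup>2 * w \<xi> ^ (k - Suc 0)))) (at \<xi>)"
      by (rule DERIV_power[OF w_deriv])
    moreover have "(w \<xi>)\<^sup>2 * w \<xi> ^ (k - Suc 0) = w \<xi> ^ Suc k"
      using assms by (simp flip: power_add)
    ultimately have pow_deriv: "((\<lambda>\<xi>. w \<xi> ^ k) has_field_derivative (- 2 * of_nat k * \<xi> * w \<xi> ^ Suc k)) (at \<xi>)"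
      by (simp add: mult_ac)
    have "((\<lambda>\<xi>. cis (t * \<xi>)) has_vector_derivative (t *\<^sub>R (\<i> * cis (t * \<xi>)))) (at \<xi>)"
      unfolding has_vector_derivative_def by (auto intro!: derivative_eq_intros simp: mult_ac)
    from has_vector_derivative_scaleR[OF pow_deriv this]
    show "(F has_vector_derivative f \<xi>) (at \<xi>)"
      unfolding F_def
      by (rule has_vector_derivative_eq_rhs)
         (simp add: f_def wt_def scaleR_conv_of_real algebra_simps)
  next
    fix \<xi> :: real
    show "isCont f \<xi>"
      unfolding f_def by (intro continuous_intros isCont_cis_mult wt_continuous)
  next
    show "set_integrable lborel (einterval (-\<infinity>) \<infinity>) f"
      using f_int by (simp add: set_integrable_def einterval_def)
  qed (use F_lim w_tendsto_0 in \<open>auto simp: ereal_tendsto_simps\<close>)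
  then have "integral\<^sup>L lborel f = 0"
    by (simp add: interval_lebesgue_integral_def set_lebesgue_integral_def einterval_def)
  moreover have "integral\<^sup>L lborel f = \<i> * of_real t * M 0 k t + 2 * of_nat k * \<i> * M 1 (Suc k) t"
    unfolding f_def M_def using int by simp
  ultimately have "\<i> * (of_real t * M 0 k t + 2 * of_nat k * M 1 (Suc k) t) = 0"
    by (simp add: algebra_simps)
  then show ?thesis
    by (simp add: add_eq_0_iff2)
qed

lemma M_even: "M 0 k (- t) = M 0 k t"
proof -
  have "M 0 k (- t) = \<bar>- 1\<bar> *\<^sub>R (\<integral>\<xi>. wt 0 k (0 + (- 1) * \<xi>) * cis (- t * (0 + (- 1) * \<xi>)) \<partial>lborel)"
    unfolding M_def by (rule lborel_integral_real_affine) simp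
  then show ?thesis
    by (simp add: M_def wt_def w_def)
qed

section \<open>The kernel for \<open>k = 1\<close> in closed form\<close>

lemma M_1: "1 \<le> k \<Longrightarrow> M 1 (Suc k) t = (- t / (2 * of_nat k)) *\<^sub>R M 0 k t"
  using M_times[of k t] by (simp add: scaleR_conv_of_real field_simps)

lemma M_2: "1 \<le> k \<Longrightarrow> M 2 (Suc k) t = of_real (a\<^sup>2) * M 0 (Suc k) t - M 0 k t"
  using M_reduce[of 0 k t] by (simp add: numeral_2_eq_2)

lemma M_0_2_deriv: "(M 0 2 has_vector_derivative (- t / 2) *\<^sub>R M 0 1 t) (at t)"
  using M_deriv[of 0 2 t] M_1[of 1 t] by (simp add: numeral_2_eq_2)

text \<open>Differentiating under the integral would leave a symbol of size
  \<open>1 / \<bar>\<xi>\<bar>\<close>, which is not integrable. Instead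
  \<open>M 1 2 = (- t / 2) *\<^sub>R M 0 1\<close> is solved for \<open>M 0 1\<close> off the
  origin; \<open>M 1 2\<close> can be differentiated under the integral, with derivative
  \<open>M 2 2\<close>.\<close>

lemma M_0_1_deriv:
  assumes "0 < t"
  shows "(M 0 1 has_vector_derivative (1 / t) *\<^sub>R (M 0 1 t - (2 * a\<^sup>2) *\<^sub>R M 0 2 t)) (at t)"
proof (rule has_vector_derivative_eq_on_pos[OF _ assms])
  show "M 0 1 s = (- 2 / s) *\<^sub>R M 1 2 s" if "0 < s" for s
    using M_1[of 1 s] that by (simp add: numeral_2_eq_2)
  have M12: "M 1 2 t = (- t / 2) *\<^sub>R M 0 1 t" and M22: "M 2 2 t = of_real (a\<^sup>2) * M 0 2 t - M 0 1 t"
    using M_1[of 1 t] M_2[of 1 t] by (simp_all add: numeral_2_eq_2)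
  have r: "((\<lambda>s. - 2 / s) has_real_derivative 2 / t\<^sup>2) (at t)"
    using assms by (auto intro!: derivative_eq_intros simp: power2_eq_square)
  have "(M 1 2 has_vector_derivative M 2 2 t) (at t)"
    using M_deriv[of 1 2 t] by (simp add: numeral_2_eq_2)
  from has_vector_derivative_scaleR[OF r this]
  show "((\<lambda>s. (- 2 / s) *\<^sub>R M 1 2 s) has_vector_derivative (1 / t) *\<^sub>R (M 0 1 t - (2 * a\<^sup>2) *\<^sub>R M 0 2 t)) (at t)"
    unfolding M12 M22 by (rule has_vector_derivative_eq_rhs)
      (use assms in \<open>simp add: scaleR_conv_of_real field_simps power2_eq_square\<close>)
qed

text \<open>The defect \<open>(1 + a t) M\<^sub>0\<^sub>1 - 2 a\<^sup>2 M\<^sub>0\<^sub>2\<close> solves a first-order linear equation whose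
  nonzero solutions grow like \<open>t e\<^sup>a\<^sup>t\<close>, so boundedness forces it to vanish.\<close>

lemma M_0_1_M_0_2:
  assumes "0 < t"
  shows "(1 + a * t) *\<^sub>R M 0 1 t = (2 * a\<^sup>2) *\<^sub>R M 0 2 t"
proof -
  define G where "G t = (1 + a * t) *\<^sub>R M 0 1 t - (2 * a\<^sup>2) *\<^sub>R M 0 2 t" for t
  define e where "e t = exp (- a * t) / t" for t
  have G_deriv: "(G has_vector_derivative ((1 + a * t) / t) *\<^sub>R G t) (at t)" if "0 < t" for t
  proof -
    have r: "((\<lambda>t. 1 + a * t) has_real_derivative a) (at t)"
      by (auto intro!: derivative_eq_intros)
    have c: "((\<lambda>t. 2 * a\<^sup>2) has_real_derivative 0) (at t)"
      by (auto intro!: derivative_eq_intros)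
    have "(G has_vector_derivative
        ((1 + a * t) *\<^sub>R ((1 / t) *\<^sub>R (M 0 1 t - (2 * a\<^sup>2) *\<^sub>R M 0 2 t)) + a *\<^sub>R M 0 1 t)
        - ((2 * a\<^sup>2) *\<^sub>R ((- t / 2) *\<^sub>R M 0 1 t) + 0 *\<^sub>R M 0 2 t)) (at t)"
      unfolding G_def
      by (rule has_vector_derivative_diff[OF has_vector_derivative_scaleR[OF r M_0_1_deriv[OF that]]
            has_vector_derivative_scaleR[OF c M_0_2_deriv]])
    then show ?thesis
    proof (rule has_vector_derivative_eq_rhs)
      have "((1 + a * t) *\<^sub>R ((1 / t) *\<^sub>R (u - (2 * a\<^sup>2) *\<^sub>R v)) + a *\<^sub>R u)
          - ((2 * a\<^sup>2) *\<^sub>R ((- t / 2) *\<^sub>R u) + 0 *\<^sub>R v)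
        = ((1 + a * t) / t + a + a\<^sup>2 * t) *\<^sub>R u - ((1 + a * t) / t * (2 * a\<^sup>2)) *\<^sub>R v" for u v :: complex
        by (simp add: scaleR_right_diff_distrib scaleR_left_distrib)
      moreover have "(1 + a * t) / t + a + a\<^sup>2 * t = (1 + a * t) / t * (1 + a * t)"
        using that by (simp add: field_simps power2_eq_square)
      ultimately show "((1 + a * t) *\<^sub>R ((1 / t) *\<^sub>R (M 0 1 t - (2 * a\<^sup>2) *\<^sub>R M 0 2 t)) + a *\<^sub>R M 0 1 t)
          - ((2 * a\<^sup>2) *\<^sub>R ((- t / 2) *\<^sub>R M 0 1 t) + 0 *\<^sub>R M 0 2 t) = ((1 + a * t) / t) *\<^sub>R G t"
        by (simp add: G_def scaleR_right_diff_distrib)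
    qed
  qed
  have e_deriv: "(e has_real_derivative - ((1 + a * t) / t) * e t) (at t)" if "0 < t" for t
    unfolding e_def using that
    by (auto intro!: derivative_eq_intros simp: field_simps power2_eq_square)
  have "((\<lambda>t. e t *\<^sub>R G t) has_vector_derivative 0) (at t)" if "0 < t" for t
    using has_vector_derivative_scaleR[OF e_deriv[OF that] G_deriv[OF that]]
    by (rule has_vector_derivative_eq_rhs) (simp add: mult.commute)
  then obtain c where c: "\<And>t. 0 < t \<Longrightarrow> e t *\<^sub>R G t = c"
    using constant_on_pos by blast
  obtain B1 B2 where B1: "\<And>t. norm (M 0 1 t) \<le> B1" and B2: "\<And>t. norm (M 0 2 t) \<le> B2"
    using M_bounded[of 0 1] M_bounded[of 0 2] by auto
  have bound: "norm (e t *\<^sub>R G t) \<le> exp (- a * t) * ((1 + a) * B1 + 2 * a\<^sup>2 * B2)" if "1 \<le> t" for t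
  proof -
    have B1_nonneg: "0 \<le> B1"
      using B1 norm_ge_zero order_trans by blast
    have "norm (G t) \<le> (1 + a * t) * norm (M 0 1 t) + 2 * a\<^sup>2 * norm (M 0 2 t)"
      unfolding G_def using a_pos that by (intro order_trans[OF norm_triangle_ineq4]) simp
    also have "\<dots> \<le> (1 + a * t) * B1 + 2 * a\<^sup>2 * B2"
      using a_pos that by (intro add_mono mult_left_mono B1 B2) auto
    also have "\<dots> \<le> t * ((1 + a) * B1) + t * (2 * a\<^sup>2 * B2)"
    proof (rule add_mono)
      show "(1 + a * t) * B1 \<le> t * ((1 + a) * B1)"
        using mult_right_mono[OF that B1_nonneg] by (simp add: algebra_simps)
      have "0 \<le> 2 * a\<^sup>2 * B2"
        using B2[of 0] norm_ge_zero[of "M 0 2 0"] by (simp del: norm_ge_zero)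
      then show "2 * a\<^sup>2 * B2 \<le> t * (2 * a\<^sup>2 * B2)"
        using mult_right_mono[OF that] by fastforce
    qed
    finally have "norm (G t) / t \<le> (1 + a) * B1 + 2 * a\<^sup>2 * B2"
      using that by (simp add: divide_le_eq distrib_left mult.commute)
    then have "exp (- a * t) * (norm (G t) / t) \<le> exp (- a * t) * ((1 + a) * B1 + 2 * a\<^sup>2 * B2)"
      by (rule mult_left_mono) simp
    then show ?thesis
      using that by (simp add: e_def)
  qed
  have "((\<lambda>t. e t *\<^sub>R G t) \<longlongrightarrow> 0) at_top"
  proof (rule Lim_null_comparison)
    show "\<forall>\<^sub>F t in at_top. norm (e t *\<^sub>R G t) \<le> exp (- a * t) * ((1 + a) * B1 + 2 * a\<^sup>2 * B2)"
      using eventually_ge_at_top[of 1] by eventually_elim (rule bound)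
    have "filterlim (\<lambda>t. - a * t) at_bot at_top"
      using a_pos filterlim_tendsto_neg_mult_at_bot[OF tendsto_const[of "- a"] _ filterlim_ident] by simp
    then have "((\<lambda>t. exp (- a * t)) \<longlongrightarrow> 0) at_top"
      by (rule filterlim_compose[OF exp_at_bot])
    then show "((\<lambda>t. exp (- a * t) * ((1 + a) * B1 + 2 * a\<^sup>2 * B2)) \<longlongrightarrow> 0) at_top"
      by (rule tendsto_mult_left_zero)
  qed
  moreover have "((\<lambda>t. e t *\<^sub>R G t) \<longlongrightarrow> c) at_top"
    by (rule tendsto_eventually[OF eventually_mono[OF eventually_gt_at_top[of 0] c]])
  ultimately have "c = 0"
    using tendsto_unique trivial_limit_at_top_linorder by blast
  then have "e t *\<^sub>R G t = 0"
    using c assms by simp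
  then show ?thesis
    using assms by (simp add: e_def G_def)
qed

text \<open>Inserting the vanishing defect into \<open>M_0_1_deriv\<close> leaves the equation
  \<open>f' = - a * f\<close> on the positive half-line. Continuity at \<open>0\<close> identifies
  the constant of integration, and evenness covers negative \<open>t\<close>.\<close>

lemma M_0_1: "M 0 1 t = exp (- a * \<bar>t\<bar>) *\<^sub>R M 0 1 0"
proof -
  have "((\<lambda>t. exp (a * t) *\<^sub>R M 0 1 t) has_vector_derivative 0) (at t)" if "0 < t" for t
  proof -
    have r: "((\<lambda>t. exp (a * t)) has_real_derivative a * exp (a * t)) (at t)"
      by (auto intro!: derivative_eq_intros)
    have eq: "(1 / t) *\<^sub>R (M 0 1 t - (2 * a\<^sup>2) *\<^sub>R M 0 2 t) = (- a) *\<^sub>R M 0 1 t"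
      unfolding M_0_1_M_0_2[OF that, symmetric] using that by (simp add: scaleR_conv_of_real field_simps)
    show ?thesis
      using has_vector_derivative_scaleR[OF r M_0_1_deriv[OF that]] unfolding eq
      by (rule has_vector_derivative_eq_rhs) (simp add: mult.commute)
  qed
  then obtain c where c: "\<And>t. 0 < t \<Longrightarrow> exp (a * t) *\<^sub>R M 0 1 t = c"
    using constant_on_pos[of "\<lambda>t. exp (a * t) *\<^sub>R M 0 1 t"] by blast
  have "isCont (\<lambda>t. exp (a * t) *\<^sub>R M 0 1 t) 0"
    by (intro continuous_intros M_continuous) auto
  then have "((\<lambda>t. exp (a * t) *\<^sub>R M 0 1 t) \<longlongrightarrow> M 0 1 0) (at_right 0)"
    unfolding isCont_def by (auto intro: filterlim_mono simp: at_within_le_at)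
  moreover have "((\<lambda>t. exp (a * t) *\<^sub>R M 0 1 t) \<longlongrightarrow> c) (at_right 0)"
    by (rule tendsto_eventually) (use c in \<open>auto simp: eventually_at_filter\<close>)
  ultimately have c_eq: "c = M 0 1 0"
    using tendsto_unique trivial_limit_at_right_real by blast
  have pos: "M 0 1 t = exp (- a * t) *\<^sub>R M 0 1 0" if "0 < t" for t
  proof -
    have "exp (- a * t) *\<^sub>R (exp (a * t) *\<^sub>R M 0 1 t) = exp (- a * t) *\<^sub>R M 0 1 0"
      using c[of t] that c_eq by simp
    then show ?thesis
      by (simp flip: exp_add)
  qed
  consider "t = 0" | "0 < t" | "0 < - t" by linarith
  then show ?thesis
  proof cases
    case 3
    then show ?thesis using pos[OF 3] M_even[of 1 t] by simp
  qed (use pos in auto)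
qed

lemma M_0_2: "M 0 2 t = ((1 + a * \<bar>t\<bar>) / (2 * a\<^sup>2)) *\<^sub>R M 0 1 t" if "t \<noteq> 0"
proof -
  have pos: "M 0 2 t = ((1 + a * t) / (2 * a\<^sup>2)) *\<^sub>R M 0 1 t" if "0 < t" for t
  proof -
    have "((1 + a * t) / (2 * a\<^sup>2)) *\<^sub>R M 0 1 t = (1 / (2 * a\<^sup>2)) *\<^sub>R ((2 * a\<^sup>2) *\<^sub>R M 0 2 t)"
      unfolding M_0_1_M_0_2[OF that, symmetric] by simp
    also have "\<dots> = M 0 2 t"
      using a_pos by simp
    finally show ?thesis by simp
  qed
  consider "0 < t" | "0 < - t" using \<open>t \<noteq> 0\<close> by linarith
  then show ?thesis
  proof cases
    case 2
    then show ?thesis using pos[OF 2] M_even[of 1 t] M_even[of 2 t] by simp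
  qed (use pos in auto)
qed

text \<open>Here \<open>M 1 (Suc k) = - t / (2 * k) * M 0 k\<close> is differentiated once more.
  Comparison with \<open>M_2\<close> eliminates the second derivative and expresses
  \<open>M 0 (Suc k)\<close> through \<open>M 0 k\<close> and \<open>t * M 1 k\<close>. For
  \<open>k \<ge> 2\<close> the derivative of \<open>M 0 k\<close> is the convergent integral
  \<open>M 1 k\<close>.\<close>

lemma M_2_by_parts:
  assumes "2 \<le> k"
  shows "M 2 (Suc k) t = (- 1 / (2 * of_nat k)) *\<^sub>R (M 0 k t + of_real t * M 1 k t)"
proof -
  have eq: "M 1 (Suc k) = (\<lambda>t. (- t / (2 * of_nat k)) *\<^sub>R M 0 k t)"
    using M_1 assms by auto
  have r: "((\<lambda>t. - t / (2 * of_nat k)) has_real_derivative - 1 / (2 * of_nat k)) (at t)"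
    by (rule DERIV_cdivide) (auto intro!: derivative_eq_intros)
  have "(M 0 k has_vector_derivative M 1 k t) (at t)"
    using M_deriv[of 0 k t] assms by simp
  from has_vector_derivative_scaleR[OF r this]
  have "(M 1 (Suc k) has_vector_derivative (- 1 / (2 * of_nat k)) *\<^sub>R (M 0 k t + of_real t * M 1 k t)) (at t)"
    unfolding eq by (rule has_vector_derivative_eq_rhs) (simp add: scaleR_conv_of_real field_simps add_divide_distrib)
  moreover have "(M 1 (Suc k) has_vector_derivative M 2 (Suc k) t) (at t)"
    using M_deriv[of 1 "Suc k" t] assms by (simp add: numeral_2_eq_2)
  ultimately show ?thesis
    using vector_derivative_unique_at by blast
qed

section \<open>Rapid decay for all exponents and derivatives\<close>

lemma rapid_scaleR: "rapid f \<Longrightarrow> rapid (\<lambda>t. c *\<^sub>R f t)"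
  using rapid_scale[of f "of_real c"] by (simp add: scaleR_conv_of_real)

lemma rapid_M_1: "1 \<le> k \<Longrightarrow> rapid (M 0 k) \<Longrightarrow> rapid (M 1 (Suc k))"
  by (rule rapid_dominated[OF rapid_scaleR[OF rapid_times, of "M 0 k" "1 / (2 * of_nat k)"]])
     (simp_all add: M_1[unfolded One_nat_def] norm_mult)

text \<open>Two consecutive exponents are carried along because the recursion reaches back two
  steps: \<open>M 1 k\<close> is a multiple of \<open>t * M 0 (k - 1)\<close>. The base pair comes
  from the closed forms for \<open>k = 1\<close> and \<open>k = 2\<close>.\<close>

lemma rapid_M_0: "rapid (M 0 (Suc n)) \<and> rapid (M 0 (Suc (Suc n)))"
proof (induction n)
  case 0
  have r1: "rapid (M 0 1)"
    using rapid_scale[OF rapid_exp[OF a_pos], of "M 0 1 0"]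
    by (rule rapid_dominated) (subst M_0_1, simp add: norm_mult mult.commute)
  have "rapid (\<lambda>t. of_real \<bar>t\<bar> * M 0 1 t)"
    using rapid_times[OF r1] by (rule rapid_dominated) (simp add: norm_mult)
  then have "rapid (\<lambda>t. (1 / (2 * a\<^sup>2)) *\<^sub>R (M 0 1 t + a *\<^sub>R (of_real \<bar>t\<bar> * M 0 1 t)))"
    by (intro rapid_scaleR rapid_add r1)
  then have "rapid (M 0 2)"
    by (rule rapid_dominated) (simp add: M_0_2 scaleR_conv_of_real add_divide_distrib distrib_left mult_ac)
  with r1 show ?case
    by (simp add: numeral_2_eq_2)
next
  case (Suc n)
  have "rapid (M 1 (Suc (Suc n)))"
    using Suc.IH by (intro rapid_M_1) auto
  then have "rapid (\<lambda>t. (1 / a\<^sup>2) *\<^sub>R (M 0 (Suc (Suc n)) t + (- 1 / (2 * of_nat (Suc (Suc n)))) *\<^sub>R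
      (M 0 (Suc (Suc n)) t + of_real t * M 1 (Suc (Suc n)) t)))"
    using Suc.IH by (intro rapid_scaleR rapid_add rapid_times) auto
  moreover have "M 0 (Suc (Suc (Suc n))) t = (1 / a\<^sup>2) *\<^sub>R (M 0 (Suc (Suc n)) t + (- 1 / (2 * of_nat (Suc (Suc n)))) *\<^sub>R
      (M 0 (Suc (Suc n)) t + of_real t * M 1 (Suc (Suc n)) t))" for t
    using a_pos by (subst M_2_by_parts[symmetric]) (simp_all add: M_2 scaleR_conv_of_real field_simps)
  ultimately show ?case
    using Suc.IH by (simp add: fun_eq_iff[symmetric])
qed

text \<open>\<open>M_reduce\<close> removes two derivatives at a time while preserving the
  convergence condition, which leaves orders \<open>0\<close> and \<open>1\<close>; order
  \<open>1\<close> forces \<open>k \<ge> 2\<close>, so \<open>rapid_M_1\<close> applies.\<close>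

lemma rapid_M: "m + 2 \<le> 2 * k \<Longrightarrow> rapid (M m k)"
proof (induction m arbitrary: k rule: less_induct)
  case (less m)
  then obtain n where k: "k = Suc n"
    by (cases k) auto
  consider "m = 0" | "m = 1" | j where "m = j + 2"
    by (metis One_nat_def Suc_1 add.commute add_Suc_right less_2_cases not_less_eq nat_le_iff_add plus_1_eq_Suc not_le)
  then show ?case
  proof cases
    case 1
    then show ?thesis using rapid_M_0 by (simp add: k)
  next
    case 2
    then obtain n' where "n = Suc n'"
      using less.prems k by (cases n) auto
    then show ?thesis using 2 rapid_M_1[of n] rapid_M_0[of n'] by (simp add: k)
  next
    case 3
    have "rapid (\<lambda>t. of_real (a\<^sup>2) * M j (Suc n) t + (- 1) * M j n t)"
      by (intro rapid_add rapid_scale less.IH) (use 3 less.prems k in auto)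
    moreover have "M m k = (\<lambda>t. of_real (a\<^sup>2) * M j (Suc n) t + (- 1) * M j n t)"
      using M_reduce[of j n] 3 less.prems k by (auto simp del: add_2_eq_Suc')
    ultimately show ?thesis by simp
  qed
qed

text \<open>The derivative of \<open>M 0 1\<close> off the origin, with a jump at \<open>0\<close>.
  It takes the place of \<open>M 1 1\<close>, whose integral does not converge absolutely.\<close>

definition DM :: "real \<Rightarrow> complex" where
  "DM t = (- a * sgn t) *\<^sub>R M 0 1 t"

lemma DM_derivs:
  assumes "t \<noteq> 0"
  shows "(M 0 1 has_vector_derivative DM t) (at t)"
    and "(DM has_vector_derivative of_real (a\<^sup>2) * M 0 1 t) (at t)"
proof -
  define s where "s = sgn t"
  have s: "s * s = 1" "t * s = \<bar>t\<bar>"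
    using assms by (auto simp: s_def sgn_if)
  \<comment> \<open>The open half-line containing \<open>t\<close>; on it
    \<open>\<bar>u\<bar> = s * u\<close>, so the exponential has a linear exponent.\<close>
  let ?S = "{u. sgn u = s}"
  have S: "open ?S" "t \<in> ?S"
  proof -
    have "?S = (if 0 < t then {0<..} else {..<0})"
      using assms by (auto simp: s_def sgn_if split: if_splits)
    then show "open ?S" by simp
  qed (simp add: s_def)
  have M: "M 0 1 u = exp (- a * s * u) *\<^sub>R M 0 1 0" if "u \<in> ?S" for u
    using that by (subst M_0_1) (auto simp: abs_sgn mult_ac)
  have r: "((\<lambda>u. exp (- a * s * u)) has_real_derivative (- a * s) * exp (- a * s * t)) (at t)"
    by (auto intro!: derivative_eq_intros)
  have 1: "((\<lambda>u. exp (- a * s * u) *\<^sub>R M 0 1 0) has_vector_derivative DM t) (at t)"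
    using has_vector_derivative_scaleR[OF r has_vector_derivative_const]
    by (rule has_vector_derivative_eq_rhs) (use M[OF S(2)] in \<open>simp add: DM_def s_def\<close>)
  show "(M 0 1 has_vector_derivative DM t) (at t)"
    by (rule has_vector_derivative_transform_within_open[OF 1 S]) (use M in auto)
  have "((\<lambda>u. (- a * s) *\<^sub>R (exp (- a * s * u) *\<^sub>R M 0 1 0)) has_vector_derivative (- a * s) *\<^sub>R DM t) (at t)"
    by (rule bounded_linear.has_vector_derivative[OF bounded_linear_scaleR_right 1])
  moreover have "(- a * s) *\<^sub>R DM t = of_real (a\<^sup>2) * M 0 1 t"
    using s(1) by (simp add: DM_def s_def scaleR_conv_of_real power2_eq_square flip: of_real_mult)
  ultimately show "(DM has_vector_derivative of_real (a\<^sup>2) * M 0 1 t) (at t)"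
    using has_vector_derivative_transform_within_open[OF _ S, of _ _ DM] M by (simp add: DM_def)
qed

lemma rapid_DM: "rapid DM"
proof (rule rapid_dominated)
  show "rapid (\<lambda>t. a *\<^sub>R M 0 1 t)"
    using rapid_M_0[of 0] by (intro rapid_scaleR) simp
qed (simp add: DM_def abs_mult sgn_if)

text \<open>The constant is the minimum of \<open>w ^ k\<close> on \<open>[-\<pi>, \<pi>]\<close>,
  attained at the endpoints. The coefficients are conjugated because, for the trigonometric sum
  \<open>P\<close> with frequencies \<open>x j\<close>, the product \<open>P * cnj P\<close> has the
  terms \<open>cnj (c i) * c j * cis ((x i - x j) * \<xi>)\<close>.\<close>

lemma M_quadratic_form:
  fixes c :: "nat \<Rightarrow> complex" and x :: "nat \<Rightarrow> real"
  assumes "1 \<le> k"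
  shows "(1 / (pi\<^sup>2 + a\<^sup>2)) ^ k *
      (L2_norm (lebesgue_on {-pi..pi}) (\<lambda>t. \<Sum>j<N. cnj (c j) * exp (\<i> * of_real (x j * t))))\<^sup>2
    \<le> Re (\<Sum>i<N. \<Sum>j<N. cnj (c i) * M 0 k (x i - x j) * c j)"
proof -
  define P where "P \<xi> = (\<Sum>j<N. cnj (c j) * cis (x j * \<xi>))" for \<xi>
  define f where "f \<xi> = w \<xi> ^ k * (norm (P \<xi>))\<^sup>2" for \<xi>
  have P_meas [measurable]: "P \<in> borel_measurable borel"
    unfolding P_def by (intro borel_measurable_continuous_onI continuous_intros)
  have int: "integrable lborel (\<lambda>\<xi>. cnj (c i) * (wt 0 k \<xi> * cis ((x i - x j) * \<xi>)) * c j)" for i j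
    using assms by (intro integrable_mult_left integrable_mult_right integrable_mult_cis integrable_wt) simp
  have f_eq: "(\<Sum>i<N. \<Sum>j<N. cnj (c i) * (wt 0 k \<xi> * cis ((x i - x j) * \<xi>)) * c j) = of_real (f \<xi>)" for \<xi>
  proof -
    have "of_real (f \<xi>) = wt 0 k \<xi> * (P \<xi> * cnj (P \<xi>))"
      unfolding f_def wt_def complex_norm_square[symmetric] by simp
    also have "P \<xi> * cnj (P \<xi>) = (\<Sum>i<N. \<Sum>j<N. cnj (c i) * cis (x i * \<xi>) * (c j * cis (- (x j * \<xi>))))"
      unfolding P_def cnj_sum sum_product by (simp add: cis_cnj)
    also have "wt 0 k \<xi> * \<dots> = (\<Sum>i<N. \<Sum>j<N. wt 0 k \<xi> * (cnj (c i) * cis (x i * \<xi>) * (c j * cis (- (x j * \<xi>)))))"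
      unfolding sum_distrib_left ..
    also have "\<dots> = (\<Sum>i<N. \<Sum>j<N. cnj (c i) * (wt 0 k \<xi> * cis ((x i - x j) * \<xi>)) * c j)"
    proof (intro sum.cong refl)
      fix i j
      have "cis ((x i - x j) * \<xi>) = cis (x i * \<xi>) * cis (- (x j * \<xi>))"
        by (simp add: cis_mult left_diff_distrib)
      then show "wt 0 k \<xi> * (cnj (c i) * cis (x i * \<xi>) * (c j * cis (- (x j * \<xi>))))
          = cnj (c i) * (wt 0 k \<xi> * cis ((x i - x j) * \<xi>)) * c j"
        by (simp only: mult_ac)
    qed
    finally show ?thesis ..
  qed
  have f_int: "integrable lborel (\<lambda>\<xi>. complex_of_real (f \<xi>))"
    unfolding f_eq[symmetric] by (intro Bochner_Integration.integrable_sum int)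
  then have f_int': "integrable lborel f"
    by (simp add: complex_of_real_integrable_eq)
  have "(\<Sum>i<N. \<Sum>j<N. cnj (c i) * M 0 k (x i - x j) * c j)
      = (\<integral>\<xi>. (\<Sum>i<N. \<Sum>j<N. cnj (c i) * (wt 0 k \<xi> * cis ((x i - x j) * \<xi>)) * c j) \<partial>lborel)"
    using int by (simp add: M_def Bochner_Integration.integral_sum)
  also have "\<dots> = of_real (integral\<^sup>L lborel f)"
    unfolding f_eq by simp
  finally have Q: "Re (\<Sum>i<N. \<Sum>j<N. cnj (c i) * M 0 k (x i - x j) * c j) = integral\<^sup>L lborel f"
    by simp
  have "(L2_norm (lebesgue_on {-pi..pi}) (\<lambda>t. \<Sum>j<N. cnj (c j) * exp (\<i> * of_real (x j * t))))\<^sup>2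
      = (\<integral>\<xi>. (norm (P \<xi>))\<^sup>2 \<partial>lebesgue_on {-pi..pi})"
    by (simp add: L2_norm_def P_def cis_conv_exp)
  also have "\<dots> = (\<integral>\<xi>. indicator {-pi..pi} \<xi> *\<^sub>R (norm (P \<xi>))\<^sup>2 \<partial>lebesgue)"
    by (rule integral_restrict_space) simp
  also have "\<dots> = (\<integral>\<xi>. indicator {-pi..pi} \<xi> *\<^sub>R (norm (P \<xi>))\<^sup>2 \<partial>lborel)"
    by (rule integral_completion) simp
  finally have L: "(L2_norm (lebesgue_on {-pi..pi}) (\<lambda>t. \<Sum>j<N. cnj (c j) * exp (\<i> * of_real (x j * t))))\<^sup>2
      = (\<integral>\<xi>. indicator {-pi..pi} \<xi> *\<^sub>R (norm (P \<xi>))\<^sup>2 \<partial>lborel)" .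
  have le: "(1 / (pi\<^sup>2 + a\<^sup>2)) ^ k * (indicator {-pi..pi} \<xi> *\<^sub>R (norm (P \<xi>))\<^sup>2) \<le> f \<xi>" for \<xi>
  proof (cases "\<xi> \<in> {-pi..pi}")
    case True
    then have "\<xi>\<^sup>2 \<le> pi\<^sup>2"
      by (intro abs_le_square_iff[THEN iffD1]) auto
    then have "1 / (pi\<^sup>2 + a\<^sup>2) \<le> w \<xi>"
      unfolding w_def using denom_pos by (intro divide_left_mono) (auto intro!: mult_pos_pos)
    then show ?thesis
      using True denom_pos[of pi] by (simp add: f_def mult_right_mono power_mono)
  qed (use w_pos[of \<xi>] in \<open>simp add: f_def\<close>)
  have ind_int: "integrable lborel (\<lambda>\<xi>. indicator {-pi..pi} \<xi> *\<^sub>R (norm (P \<xi>))\<^sup>2)"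
    unfolding P_def by (intro borel_integrable_compact continuous_intros) simp
  show ?thesis
    unfolding L Q
    by (subst integral_mult_right_zero[symmetric], rule integral_mono[OF integrable_mult_right[OF ind_int] f_int' le])
qed

end

section \<open>Series of translates\<close>

lemma summable_inverse_1_plus_square:
  assumes "0 < \<delta>"
  shows "summable (\<lambda>n. 1 / (1 + (\<delta> * real n)\<^sup>2))"
proof (rule summable_comparison_test)
  show "summable (\<lambda>n. (1 / \<delta>\<^sup>2) * inverse (real n ^ 2))"
    by (intro summable_mult inverse_power_summable) auto
  show "\<exists>N. \<forall>n\<ge>N. norm (1 / (1 + (\<delta> * real n)\<^sup>2)) \<le> (1 / \<delta>\<^sup>2) * inverse (real n ^ 2)"
  proof (intro exI[of _ 1] allI impI)
    fix n :: nat assume "1 \<le> n"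
    then have "0 < (\<delta> * real n)\<^sup>2"
      using assms by simp
    then have "1 / (1 + (\<delta> * real n)\<^sup>2) \<le> 1 / (\<delta> * real n)\<^sup>2"
      by (intro divide_left_mono) (auto intro!: mult_pos_pos add_pos_pos)
    then show "norm (1 / (1 + (\<delta> * real n)\<^sup>2)) \<le> (1 / \<delta>\<^sup>2) * inverse (real n ^ 2)"
      by (simp add: power_mult_distrib divide_inverse)
  qed
qed

text \<open>Each cell \<open>[\<delta> * n, \<delta> * (n + 1))\<close> contains at most one of the
  points. Rounding down to the left end of the cell is thus injective, and it only increases the
  summands.\<close>

lemma sum_separated_nonneg:
  fixes s :: "nat \<Rightarrow> real"
  assumes "0 < \<delta>" "finite J" "\<And>j. j \<in> J \<Longrightarrow> 0 \<le> s j"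
    and sep: "\<And>i j. i \<in> J \<Longrightarrow> j \<in> J \<Longrightarrow> i \<noteq> j \<Longrightarrow> \<delta> \<le> \<bar>s i - s j\<bar>"
  shows "(\<Sum>j\<in>J. 1 / (1 + (s j)\<^sup>2)) \<le> (\<Sum>n. 1 / (1 + (\<delta> * real n)\<^sup>2))"
proof -
  define f where "f j = nat \<lfloor>s j / \<delta>\<rfloor>" for j
  have f: "\<delta> * real (f j) \<le> s j" "s j < \<delta> * real (f j) + \<delta>" if "j \<in> J" for j
  proof -
    have "real (f j) = of_int \<lfloor>s j / \<delta>\<rfloor>"
      using assms(1) assms(3)[OF that] by (simp add: f_def)
    then have "real (f j) \<le> s j / \<delta>" "s j / \<delta> < real (f j) + 1"
      by linarith+
    then show "\<delta> * real (f j) \<le> s j" "s j < \<delta> * real (f j) + \<delta>"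
      using assms(1) by (simp_all add: field_simps)
  qed
  have inj: "inj_on f J"
  proof (rule inj_onI, rule ccontr)
    fix i j assume ij: "i \<in> J" "j \<in> J" "f i = f j" "i \<noteq> j"
    then show False
      using f[of i] f[of j] sep[of i j] by simp
  qed
  have "(\<Sum>j\<in>J. 1 / (1 + (s j)\<^sup>2)) \<le> (\<Sum>j\<in>J. 1 / (1 + (\<delta> * real (f j))\<^sup>2))"
  proof (rule sum_mono)
    fix j assume "j \<in> J"
    then have "(\<delta> * real (f j))\<^sup>2 \<le> (s j)\<^sup>2"
      using f(1) assms(1) by (intro power_mono) auto
    then show "1 / (1 + (s j)\<^sup>2) \<le> 1 / (1 + (\<delta> * real (f j))\<^sup>2)"
      by (intro divide_left_mono) (auto intro!: mult_pos_pos add_pos_nonneg)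
  qed
  also have "\<dots> = (\<Sum>n\<in>f ` J. 1 / (1 + (\<delta> * real n)\<^sup>2))"
    by (simp add: sum.reindex[OF inj])
  also have "\<dots> \<le> (\<Sum>n. 1 / (1 + (\<delta> * real n)\<^sup>2))"
    using assms by (intro sum_le_suminf summable_inverse_1_plus_square) (auto intro: add_nonneg_nonneg)
  finally show ?thesis .
qed

text \<open>The factor \<open>2\<close> accounts for points on both sides of the origin.\<close>

definition separation_const :: "real \<Rightarrow> real" where
  "separation_const \<delta> = 2 * (\<Sum>n. 1 / (1 + (\<delta> * real n)\<^sup>2))"

lemma sum_separated:
  fixes s :: "nat \<Rightarrow> real"
  assumes "0 < \<delta>" "finite J"
    and sep: "\<And>i j. i \<noteq> j \<Longrightarrow> \<delta> \<le> \<bar>s i - s j\<bar>"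
  shows "(\<Sum>j\<in>J. 1 / (1 + (s j)\<^sup>2)) \<le> separation_const \<delta>"
proof -
  let ?P = "{j \<in> J. 0 \<le> s j}"
  have "(\<Sum>j\<in>J. 1 / (1 + (s j)\<^sup>2)) = (\<Sum>j\<in>?P. 1 / (1 + (s j)\<^sup>2)) + (\<Sum>j\<in>J - ?P. 1 / (1 + (s j)\<^sup>2))"
    using assms(2) by (subst sum.subset_diff[of ?P J]) auto
  also have "(\<Sum>j\<in>?P. 1 / (1 + (s j)\<^sup>2)) \<le> (\<Sum>n. 1 / (1 + (\<delta> * real n)\<^sup>2))"
    using assms by (intro sum_separated_nonneg) auto
  also have "(\<Sum>j\<in>J - ?P. 1 / (1 + (s j)\<^sup>2)) = (\<Sum>j\<in>J - ?P. 1 / (1 + (- s j)\<^sup>2))"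
    by simp
  also have "\<dots> \<le> (\<Sum>n. 1 / (1 + (\<delta> * real n)\<^sup>2))"
  proof (rule sum_separated_nonneg)
    show "\<delta> \<le> \<bar>- s i - - s j\<bar>" if "i \<noteq> j" for i j
      using sep[OF that] by (simp add: abs_minus_commute)
  qed (use assms in auto)
  finally show ?thesis
    by (simp add: separation_const_def)
qed

definition decay2 :: "(real \<Rightarrow> complex) \<Rightarrow> bool" where
  "decay2 g \<longleftrightarrow> (\<exists>C\<ge>0. \<forall>t. norm (g t) \<le> C / (1 + t\<^sup>2))"

lemma rapid_decay2: "rapid g \<Longrightarrow> decay2 g"
  unfolding decay2_def by (metis rapid_bound)

lemma decay2_le:
  assumes "0 \<le> C" "\<And>t. norm (g t) \<le> C / (1 + t\<^sup>2)"
  shows "norm (g t) \<le> C"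
proof -
  have "C / (1 + t\<^sup>2) \<le> C / 1"
    using assms(1) by (intro divide_left_mono) (auto intro!: add_pos_nonneg)
  with assms(2)[of t] show ?thesis by simp
qed

lemma decay2_tendsto:
  assumes "decay2 g"
  shows "((\<lambda>t. g (t - x)) \<longlongrightarrow> 0) at_infinity"
proof -
  obtain C where C: "0 \<le> C" "\<And>t. norm (g t) \<le> C / (1 + t\<^sup>2)"
    using assms unfolding decay2_def by blast
  have le: "norm (g t) \<le> norm (C / t)" if "t \<noteq> 0" for t
  proof -
    have "\<bar>t\<bar> \<le> 1 + t\<^sup>2"
      using zero_le_power2[of "\<bar>t\<bar> - 1"] by (simp add: power2_diff)
    then have "C / (1 + t\<^sup>2) \<le> C / \<bar>t\<bar>"
      using C(1) that by (intro divide_left_mono) (auto intro!: mult_pos_pos add_pos_nonneg)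
    with C(2)[of t] C(1) show ?thesis by simp
  qed
  have "((\<lambda>t::real. C / t) \<longlongrightarrow> 0) at_infinity"
    by (intro tendsto_divide_0[OF tendsto_const] filterlim_ident)
  then have "((\<lambda>t. norm (C / t)) \<longlongrightarrow> 0) at_infinity"
    by (rule tendsto_norm_zero)
  then have "(g \<longlongrightarrow> 0) at_infinity"
  proof (rule Lim_null_comparison[rotated])
    show "\<forall>\<^sub>F t in at_infinity. norm (g t) \<le> norm (C / t)"
      unfolding eventually_at_infinity using le by (intro exI[of _ 1]) auto
  qed
  moreover have "filterlim (\<lambda>t. - x + t) at_infinity at_infinity"
    by (rule tendsto_add_filterlim_at_infinity[OF tendsto_const filterlim_ident])
  ultimately show ?thesis
    by (auto dest: filterlim_compose)
qed

lemma translate_deriv: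
  fixes g :: "real \<Rightarrow> complex"
  assumes "(g has_vector_derivative d) (at (t - a))"
  shows "((\<lambda>t. g (t - a) * b) has_vector_derivative d * b) (at t)"
proof -
  have "((\<lambda>t. t - a) has_vector_derivative 1 - 0) (at t)"
    by (rule has_vector_derivative_diff[OF has_vector_derivative_id has_vector_derivative_const])
  then have "((\<lambda>t. t - a) has_vector_derivative 1) (at t)"
    by simp
  from vector_diff_chain_at[OF this assms]
  have "((\<lambda>t. g (t - a)) has_vector_derivative d) (at t)"
    by (simp add: comp_def)
  then show ?thesis
    by (rule has_vector_derivative_mult_left)
qed

text \<open>\<open>has_derivative_series\<close> provides some differentiable sum; uniqueness of
  limits identifies it with \<open>G\<close> on the open set \<open>U\<close>, hence near
  \<open>t\<close>.\<close>

lemma series_deriv: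
  fixes G G' :: "real \<Rightarrow> complex" and f f' :: "nat \<Rightarrow> real \<Rightarrow> complex"
  assumes U: "convex U" "open U" "t \<in> U"
    and sums: "\<And>t. t \<in> U \<Longrightarrow> (\<lambda>j. f j t) sums G t"
    and deriv: "\<And>j t. t \<in> U \<Longrightarrow> (f j has_vector_derivative f' j t) (at t)"
    and unif: "\<And>e. 0 < e \<Longrightarrow> \<forall>\<^sub>F n in sequentially. \<forall>t\<in>U. norm ((\<Sum>i<n. f' i t) - G' t) \<le> e"
  shows "(G has_vector_derivative G' t) (at t)"
proof -
  have "\<exists>H. \<forall>t\<in>U. (\<lambda>j. f j t) sums H t \<and> (H has_derivative (\<lambda>h. h *\<^sub>R G' t)) (at t within U)"
  proof (rule has_derivative_series[where f=f and f'="\<lambda>j t h. h *\<^sub>R f' j t" and g'="\<lambda>t h. h *\<^sub>R G' t", OF U(1) _ _ U(3) sums[OF U(3)]])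
    show "(f n has_derivative (\<lambda>h. h *\<^sub>R f' n t)) (at t within U)" if "t \<in> U" for n t
      using deriv[OF that] unfolding has_vector_derivative_def by (rule has_derivative_at_withinI)
  next
    fix e :: real assume "0 < e"
    from unif[OF this]
    show "\<forall>\<^sub>F n in sequentially. \<forall>t\<in>U. \<forall>h. norm ((\<Sum>i<n. h *\<^sub>R f' i t) - h *\<^sub>R G' t) \<le> e * norm h"
    proof (rule eventually_mono)
      fix n assume n: "\<forall>t\<in>U. norm ((\<Sum>i<n. f' i t) - G' t) \<le> e"
      show "\<forall>t\<in>U. \<forall>h. norm ((\<Sum>i<n. h *\<^sub>R f' i t) - h *\<^sub>R G' t) \<le> e * norm h"
      proof (intro ballI allI)
        fix t h assume t: "t \<in> U"
        have "norm ((\<Sum>i<n. h *\<^sub>R f' i t) - h *\<^sub>R G' t) = norm h * norm ((\<Sum>i<n. f' i t) - G' t)"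
          by (simp only: scaleR_sum_right[symmetric] scaleR_diff_right[symmetric] norm_scaleR real_norm_def)
        also have "\<dots> \<le> norm h * e"
          by (rule mult_left_mono[OF n[rule_format, OF t] norm_ge_zero])
        finally show "norm ((\<Sum>i<n. h *\<^sub>R f' i t) - h *\<^sub>R G' t) \<le> e * norm h"
          by (simp only: mult.commute)
      qed
    qed
  qed
  then obtain H where H: "\<And>t. t \<in> U \<Longrightarrow> (\<lambda>j. f j t) sums H t"
    "\<And>t. t \<in> U \<Longrightarrow> (H has_derivative (\<lambda>h. h *\<^sub>R G' t)) (at t within U)"
    by blast
  have "(H has_vector_derivative G' t) (at t)"
    using H(2)[OF U(3)] unfolding has_vector_derivative_def at_within_open[OF U(3,2)] .
  then show ?thesis
    by (rule has_vector_derivative_transform_within_open[OF _ U(2,3)])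
       (rule sums_unique2[OF H(1) sums])
qed

section \<open>Square-summable combinations of translates\<close>

locale translates =
  fixes x :: "nat \<Rightarrow> real" and \<delta> :: real and c :: "nat \<Rightarrow> complex"
  assumes \<delta>_pos: "0 < \<delta>"
    and sep: "\<And>i j. i \<noteq> j \<Longrightarrow> \<delta> \<le> \<bar>x i - x j\<bar>"
    and c_l2: "summable (\<lambda>j. (norm (c j))\<^sup>2)"
begin

definition S :: "(real \<Rightarrow> complex) \<Rightarrow> real \<Rightarrow> complex" where
  "S g t = (\<Sum>j. g (t - x j) * c j)"

lemma separation_const_nonneg: "0 \<le> separation_const \<delta>"
  using sum_separated[OF \<delta>_pos _ sep, of "{}"] by simp

lemma sum_kernel_le: "finite J \<Longrightarrow> (\<Sum>j\<in>J. 1 / (1 + (t - x j)\<^sup>2)) \<le> separation_const \<delta>"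
  by (rule sum_separated[OF \<delta>_pos]) (use sep in \<open>auto simp: abs_minus_commute\<close>)

lemma sum_norm_le_kernel:
  assumes C: "0 \<le> C" "\<And>t. norm (g t) \<le> C / (1 + t\<^sup>2)" and "finite J"
  shows "(\<Sum>j\<in>J. norm (g (t - x j))) \<le> C * separation_const \<delta>"
proof -
  have "(\<Sum>j\<in>J. norm (g (t - x j))) \<le> (\<Sum>j\<in>J. C * (1 / (1 + (t - x j)\<^sup>2)))"
    using C(2) by (intro sum_mono) simp
  also have "\<dots> \<le> C * separation_const \<delta>"
    unfolding sum_distrib_left[symmetric] by (intro mult_left_mono sum_kernel_le assms)
  finally show ?thesis .
qed

text \<open>The shift by \<open>N\<close> gives the tails of the series the same bound as the whole
  series.\<close>

lemma kernel_row:
  assumes C: "0 \<le> C" "\<And>t. norm (g t) \<le> C / (1 + t\<^sup>2)"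
  shows "summable (\<lambda>j. norm (g (t - x (j + N))))"
    and "(\<Sum>j. norm (g (t - x (j + N)))) \<le> C * separation_const \<delta>"
proof -
  have "(\<Sum>j<n. norm (g (t - x (j + N)))) \<le> C * separation_const \<delta>" for n
  proof -
    have "(\<Sum>j<n. norm (g (t - x (j + N)))) = (\<Sum>j\<in>(\<lambda>j. j + N) ` {..<n}. norm (g (t - x j)))"
      by (simp add: sum.reindex)
    also have "\<dots> \<le> C * separation_const \<delta>"
      by (rule sum_norm_le_kernel[OF C]) auto
    finally show ?thesis .
  qed
  then show "summable (\<lambda>j. norm (g (t - x (j + N))))"
    "(\<Sum>j. norm (g (t - x (j + N)))) \<le> C * separation_const \<delta>"
    by (rule summable_partial_sums_bounded[OF norm_ge_zero])+
qed

lemma kernel_weighted: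
  assumes C: "0 \<le> C" "\<And>t. norm (g t) \<le> C / (1 + t\<^sup>2)"
  shows "summable (\<lambda>j. norm (g (t - x (j + N))) * (norm (c (j + N)))\<^sup>2)"
    and "summable (\<lambda>j. norm (g (t - x (j + N)) * c (j + N)))"
    and "(norm (\<Sum>j. g (t - x (j + N)) * c (j + N)))\<^sup>2
      \<le> (C * separation_const \<delta>) * (\<Sum>j. norm (g (t - x (j + N))) * (norm (c (j + N)))\<^sup>2)"
proof -
  note g_le = decay2_le[OF C]
  have c: "summable (\<lambda>j. (norm (c (j + N)))\<^sup>2)"
    using c_l2 by (simp add: summable_iff_shift[of "\<lambda>j. (norm (c j))\<^sup>2"])
  show s: "summable (\<lambda>j. norm (g (t - x (j + N))) * (norm (c (j + N)))\<^sup>2)"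
    by (rule summable_bounded_mult[OF norm_ge_zero g_le zero_le_power2 c])
  note W = weighted_Cauchy_Schwarz_norm[OF kernel_row(1)[OF C, of t N] s]
  show "summable (\<lambda>j. norm (g (t - x (j + N)) * c (j + N)))"
    by (rule W(1))
  show "(norm (\<Sum>j. g (t - x (j + N)) * c (j + N)))\<^sup>2
      \<le> (C * separation_const \<delta>) * (\<Sum>j. norm (g (t - x (j + N))) * (norm (c (j + N)))\<^sup>2)"
    by (rule order_trans[OF W(2)], intro mult_right_mono kernel_row(2)[OF C] suminf_nonneg s) auto
qed

lemma S_summable_norm: "decay2 g \<Longrightarrow> summable (\<lambda>j. norm (g (t - x j) * c j))"
  unfolding decay2_def using kernel_weighted(2)[where N=0] by fastforce

lemma S_sums: "decay2 g \<Longrightarrow> (\<lambda>j. g (t - x j) * c j) sums S g t"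
  unfolding S_def by (rule summable_sums[OF summable_norm_cancel[OF S_summable_norm]])

text \<open>Separation bounds the sums of kernel values uniformly in \<open>t\<close>, so weighted
  Cauchy-Schwarz estimates the tail of the series by the square sum of the tail of \<open>c\<close>,
  in which \<open>t\<close> no longer occurs.\<close>

lemma S_uniform:
  assumes "decay2 g" "0 < e"
  shows "\<forall>\<^sub>F N in sequentially. \<forall>t. norm ((\<Sum>j<N. g (t - x j) * c j) - S g t) \<le> e"
proof -
  obtain C where C: "0 \<le> C" "\<And>t. norm (g t) \<le> C / (1 + t\<^sup>2)"
    using assms unfolding decay2_def by blast
  note g_le = decay2_le[OF C]
  define K where "K = C * separation_const \<delta>"
  have K: "0 \<le> K"
    unfolding K_def by (intro mult_nonneg_nonneg C(1) separation_const_nonneg)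
  define T where "T N = (\<Sum>j. (norm (c (j + N)))\<^sup>2)" for N
  have tail: "norm ((\<Sum>j<N. g (t - x j) * c j) - S g t) \<le> sqrt (K * (C * T N))" for N t
  proof -
    have "S g t - (\<Sum>j<N. g (t - x j) * c j) = (\<Sum>j. g (t - x (j + N)) * c (j + N))"
      using suminf_minus_initial_segment[OF sums_summable[OF S_sums[OF assms(1), of t]], of N]
      by (simp add: S_def)
    moreover have "norm (\<Sum>j. g (t - x (j + N)) * c (j + N)) \<le> sqrt (K * (C * T N))"
    proof (rule real_le_rsqrt)
      have c: "summable (\<lambda>j. (norm (c (j + N)))\<^sup>2)"
        using c_l2 by (simp add: summable_iff_shift[of "\<lambda>j. (norm (c j))\<^sup>2"])
      have "(\<Sum>j. norm (g (t - x (j + N))) * (norm (c (j + N)))\<^sup>2) \<le> (\<Sum>j. C * (norm (c (j + N)))\<^sup>2)"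
        by (intro suminf_le kernel_weighted(1)[OF C] summable_mult c mult_right_mono g_le) auto
      also have "\<dots> = C * T N"
        unfolding T_def by (rule suminf_mult[OF c])
      finally show "(norm (\<Sum>j. g (t - x (j + N)) * c (j + N)))\<^sup>2 \<le> K * (C * T N)"
        using K by (intro order_trans[OF kernel_weighted(3)[OF C]]) (simp add: K_def mult_left_mono)
    qed
    ultimately show ?thesis
      by (metis norm_minus_commute)
  qed
  have "(\<lambda>N. T N) \<longlonglongrightarrow> 0"
    unfolding T_def by (rule suminf_exist_split2[OF c_l2])
  then have "(\<lambda>N. sqrt (K * (C * T N))) \<longlonglongrightarrow> sqrt (K * (C * 0))"
    by (intro tendsto_intros)
  then have "\<forall>\<^sub>F N in sequentially. sqrt (K * (C * T N)) < e"
    using assms(2) by (intro order_tendstoD(2)) auto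
  then show ?thesis
    by eventually_elim (use tail order_trans less_imp_le in meson)
qed

lemma S_C0:
  assumes "decay2 g" "\<And>t. isCont g t"
  shows "S g \<in> C0"
proof -
  have unif: "uniform_limit UNIV (\<lambda>N t. \<Sum>j<N. g (t - x j) * c j) (S g) sequentially"
  proof (rule uniform_limitI)
    fix e :: real assume "0 < e"
    then have "\<forall>\<^sub>F N in sequentially. \<forall>t. norm ((\<Sum>j<N. g (t - x j) * c j) - S g t) \<le> e / 2"
      by (intro S_uniform assms) simp
    then show "\<forall>\<^sub>F N in sequentially. \<forall>t\<in>UNIV. dist (\<Sum>j<N. g (t - x j) * c j) (S g t) < e"
    proof eventually_elim
      case (elim N)
      show ?case
      proof
        fix t
        show "dist (\<Sum>j<N. g (t - x j) * c j) (S g t) < e"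
          using elim[rule_format, of t] \<open>0 < e\<close> by (simp add: dist_norm)
      qed
    qed
  qed
  have g_cont: "continuous_on UNIV g"
    using assms(2) by (simp add: continuous_on_eq_continuous_at)
  have "continuous_on UNIV (S g)"
  proof (rule uniform_limit_theorem[OF _ unif])
    show "\<forall>\<^sub>F N in sequentially. continuous_on UNIV (\<lambda>t. \<Sum>j<N. g (t - x j) * c j)"
    proof (intro always_eventually allI continuous_on_sum continuous_on_mult continuous_on_const)
      show "continuous_on UNIV (\<lambda>t. g (t - x j))" for j
        by (rule continuous_on_compose2[OF g_cont]) (auto intro: continuous_intros)
    qed
  qed auto
  moreover have "(S g \<longlongrightarrow> 0) at_infinity"
  proof (rule tendstoI)
    fix e :: real assume e: "0 < e"
    then obtain N where N: "\<And>t. norm ((\<Sum>j<N. g (t - x j) * c j) - S g t) \<le> e / 2"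
      using eventually_happens[OF S_uniform[OF assms(1), of "e / 2"]] by auto
    have "((\<lambda>t. \<Sum>j<N. g (t - x j) * c j) \<longlongrightarrow> 0) at_infinity"
      by (intro tendsto_null_sum tendsto_mult_left_zero decay2_tendsto assms)
    then have "\<forall>\<^sub>F t in at_infinity. dist (\<Sum>j<N. g (t - x j) * c j) 0 < e / 2"
      using e by (intro tendstoD) auto
    then show "\<forall>\<^sub>F t in at_infinity. dist (S g t) 0 < e"
    proof eventually_elim
      case (elim t)
      have "norm (S g t) \<le> norm (\<Sum>j<N. g (t - x j) * c j) + norm ((\<Sum>j<N. g (t - x j) * c j) - S g t)"
        using norm_triangle_sub[of "S g t" "\<Sum>j<N. g (t - x j) * c j"] by (simp add: norm_minus_commute)
      then show ?case
        using elim N[of t] by (simp add: dist_norm)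
    qed
  qed
  ultimately show ?thesis
    by (simp add: C0_def)
qed

text \<open>\<open>U\<close> is the whole line for kernels differentiable everywhere, and a ball
  free of nodes when the kernel has a kink at the origin. Convexity is what termwise differentiation
  asks for.\<close>

lemma S_deriv:
  assumes g: "decay2 g" and g': "decay2 g'" and U: "convex U" "open U" "t \<in> U"
    and deriv: "\<And>t j. t \<in> U \<Longrightarrow> (g has_vector_derivative g' (t - x j)) (at (t - x j))"
  shows "(S g has_vector_derivative S g' t) (at t)"
proof (rule series_deriv[OF U])
  show "(\<lambda>j. g (t - x j) * c j) sums S g t" for t
    by (rule S_sums[OF g])
  show "((\<lambda>t. g (t - x j) * c j) has_vector_derivative g' (t - x j) * c j) (at t)" if "t \<in> U" for j t
    by (rule translate_deriv[OF deriv[OF that]])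
  show "\<forall>\<^sub>F n in sequentially. \<forall>t\<in>U. norm ((\<Sum>i<n. g' (t - x i) * c i) - S g' t) \<le> e" if "0 < e" for e
    by (rule eventually_mono[OF S_uniform[OF g' that]]) blast
qed

lemma S_diff:
  assumes "decay2 f" "decay2 g"
  shows "S (\<lambda>t. a * f t - g t) t = a * S f t - S g t"
proof -
  have "(\<lambda>j. a * (f (t - x j) * c j) - g (t - x j) * c j) sums (a * S f t - S g t)"
    by (intro sums_diff sums_mult S_sums assms)
  then show ?thesis
    unfolding S_def[of "\<lambda>t. a * f t - g t"] by (simp add: sums_iff algebra_simps)
qed

text \<open>Schur's test once more: weighted Cauchy-Schwarz at each \<open>t\<close> gives a
  majorant of the squared norm that is linear in \<open>(norm (c j))^2\<close>. Its terms are
  multiples of translates of one integrable function, so integrating term by term leaves a multiple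
  of the square sum of \<open>c\<close>.\<close>

lemma S_L2:
  assumes g: "decay2 g" and cont: "\<And>t. isCont g t"
  shows "S g \<in> L2_fun lebesgue"
proof -
  obtain C where C: "0 \<le> C" "\<And>t. norm (g t) \<le> C / (1 + t\<^sup>2)"
    using g unfolding decay2_def by blast
  define K where "K = C * separation_const \<delta>"
  have K: "0 \<le> K"
    unfolding K_def by (intro mult_nonneg_nonneg C(1) separation_const_nonneg)
  define p where "p = (\<lambda>t::real. inverse (1 + t\<^sup>2))"
  have p: "integrable lborel p"
    using integrable_inverse_1_plus_square by (simp add: set_integrable_def einterval_def p_def)
  have p_shift: "integrable lborel (\<lambda>t. p (t - x j))" "(\<integral>t. p (t - x j) \<partial>lborel) = (\<integral>t. p t \<partial>lborel)" for j
    using lborel_integrable_real_affine[OF p, of 1 "- x j"] lborel_integral_real_affine[of 1 p "- x j"]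
    by simp_all
  have S_meas: "S g \<in> borel_measurable borel"
    using S_C0[OF assms] unfolding C0_def by (intro borel_measurable_continuous_onI) simp
  define q where "q t j = (K * C * (norm (c j))\<^sup>2) * p (t - x j)" for t j
  have q_nonneg: "0 \<le> q t j" for t j
    using K C(1) by (simp add: q_def p_def add_nonneg_nonneg)
  have q_summable: "summable (\<lambda>j. q t j)" for t
  proof -
    have "summable (\<lambda>j. p (t - x j) * (K * C * (norm (c j))\<^sup>2))"
    proof (rule summable_bounded_mult[where C=1])
      show "0 \<le> p (t - x j)" "p (t - x j) \<le> 1" for j
        by (simp_all add: p_def add_nonneg_nonneg inverse_le_1_iff)
      show "summable (\<lambda>j. K * C * (norm (c j))\<^sup>2)"
        by (rule summable_mult[OF c_l2])
    qed (use K C(1) in simp)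
    then show ?thesis
      by (simp add: q_def mult.commute)
  qed
  have int: "integrable lborel (\<lambda>t. \<Sum>j. q t j)"
  proof (rule integrable_suminf)
    show "integrable lborel (\<lambda>t. q t j)" for j
      unfolding q_def by (intro integrable_mult_right p_shift)
    show "AE t in lborel. summable (\<lambda>j. norm (q t j))"
      using q_summable q_nonneg by simp
    have "(\<integral>t. norm (q t j) \<partial>lborel) = (K * C * (\<integral>t. p t \<partial>lborel)) * (norm (c j))\<^sup>2" for j
    proof -
      have "(\<integral>t. norm (q t j) \<partial>lborel) = (\<integral>t. (K * C * (norm (c j))\<^sup>2) * p (t - x j) \<partial>lborel)"
        using q_nonneg by (simp add: q_def)
      also have "\<dots> = (K * C * (norm (c j))\<^sup>2) * (\<integral>t. p (t - x j) \<partial>lborel)"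
        by simp
      finally show ?thesis
        by (simp add: p_shift(2) mult_ac)
    qed
    then show "summable (\<lambda>j. \<integral>t. norm (q t j) \<partial>lborel)"
      using c_l2 by (simp add: summable_mult)
  qed
  have "(norm (S g t))\<^sup>2 \<le> (\<Sum>j. q t j)" for t
  proof -
    have "(norm (S g t))\<^sup>2 \<le> K * (\<Sum>j. norm (g (t - x j)) * (norm (c j))\<^sup>2)"
      using kernel_weighted(3)[OF C, of t 0] by (simp add: S_def K_def)
    also have "\<dots> = (\<Sum>j. K * (norm (g (t - x j)) * (norm (c j))\<^sup>2))"
      using kernel_weighted(1)[OF C, of t 0] by (intro suminf_mult[symmetric]) simp
    also have "\<dots> \<le> (\<Sum>j. q t j)"
    proof (rule suminf_le[OF _ _ q_summable])
      show "summable (\<lambda>j. K * (norm (g (t - x j)) * (norm (c j))\<^sup>2))"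
        using kernel_weighted(1)[OF C, of t 0] by (intro summable_mult) simp
      fix j
      have "norm (g (t - x j)) * (norm (c j))\<^sup>2 \<le> (C * p (t - x j)) * (norm (c j))\<^sup>2"
        using C(2)[of "t - x j"] by (intro mult_right_mono) (auto simp: p_def divide_inverse)
      then have "K * (norm (g (t - x j)) * (norm (c j))\<^sup>2) \<le> K * ((C * p (t - x j)) * (norm (c j))\<^sup>2)"
        by (rule mult_left_mono[OF _ K])
      also have "K * ((C * p (t - x j)) * (norm (c j))\<^sup>2) = q t j"
        by (simp only: q_def mult_ac)
      finally show "K * (norm (g (t - x j)) * (norm (c j))\<^sup>2) \<le> q t j" .
    qed
    finally show ?thesis .
  qed
  then have "integrable lborel (\<lambda>t. (norm (S g t))\<^sup>2)"
    using S_meas suminf_nonneg[OF q_summable q_nonneg]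
    by (intro Bochner_Integration.integrable_bound[OF int]) auto
  then have "integrable lebesgue (\<lambda>t. (norm (S g t))\<^sup>2)"
    using S_meas by (subst integrable_completion) auto
  then show ?thesis
    unfolding L2_fun_def using S_meas by (simp add: measurable_completion)
qed

lemma closed_range: "closed (range x)"
proof (rule discrete_imp_closed[OF \<delta>_pos])
  show "\<forall>u\<in>range x. \<forall>v\<in>range x. dist v u < \<delta> \<longrightarrow> v = u"
  proof (intro ballI impI)
    fix u v assume "u \<in> range x" "v \<in> range x" "dist v u < \<delta>"
    then obtain i j where ij: "u = x i" "v = x j"
      by blast
    then have "\<bar>x j - x i\<bar> < \<delta>"
      using \<open>dist v u < \<delta>\<close> by (simp add: dist_real_def)
    then show "v = u"
      using ij sep[of j i] by (cases "j = i") auto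
  qed
qed

end

section \<open>The differential equation and interpolation\<close>

lemma D_eqI: "(u has_vector_derivative d) (at t) \<Longrightarrow> D u t = d"
  unfolding D_def by (rule vector_derivative_at)

lemma has_vector_derivative_cong_open:
  assumes "open U" "\<And>t. t \<in> U \<Longrightarrow> u t = v t" "t \<in> U"
  shows "(u has_vector_derivative d) (at t) \<longleftrightarrow> (v has_vector_derivative d) (at t)"
  using has_vector_derivative_transform_within_open[of u d t U v]
    has_vector_derivative_transform_within_open[of v d t U u] assms by auto

lemma D_cong:
  assumes "open U" "\<And>t. t \<in> U \<Longrightarrow> u t = v t" "t \<in> U"
  shows "D u t = D v t"
proof -
  have "(\<lambda>d. (u has_vector_derivative d) (at t)) = (\<lambda>d. (v has_vector_derivative d) (at t))"
    by (rule ext) (rule has_vector_derivative_cong_open[OF assms])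
  then show ?thesis
    by (simp only: D_def vector_derivative_def)
qed

lemma differentiable_cong_open:
  fixes u v :: "real \<Rightarrow> complex"
  assumes "open U" "\<And>t. t \<in> U \<Longrightarrow> u t = v t" "t \<in> U"
  shows "u differentiable (at t) \<longleftrightarrow> v differentiable (at t)"
  unfolding vector_derivative_works
  using has_vector_derivative_cong_open[OF assms] D_cong[OF assms] unfolding D_def by simp

lemma times_differentiable_on_0 [simp]: "times_differentiable_on 0 u U"
  by (simp add: times_differentiable_on_def)

lemma times_differentiable_on_Suc:
  "times_differentiable_on (Suc n) u U \<longleftrightarrow>
    (\<forall>t\<in>U. u differentiable (at t)) \<and> times_differentiable_on n (D u) U"
  unfolding times_differentiable_on_def
  by (auto simp: less_Suc_eq_0_disj funpow_Suc_right simp del: funpow.simps(2))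

lemma times_differentiable_on_cong:
  assumes "open U" "\<And>t. t \<in> U \<Longrightarrow> u t = v t"
  shows "times_differentiable_on n u U \<longleftrightarrow> times_differentiable_on n v U"
  using assms(2)
proof (induction n arbitrary: u v)
  case (Suc n)
  have "times_differentiable_on n (D u) U \<longleftrightarrow> times_differentiable_on n (D v) U"
    by (rule Suc.IH) (rule D_cong[OF assms(1) Suc.prems])
  moreover have "u differentiable (at t) \<longleftrightarrow> v differentiable (at t)" if "t \<in> U" for t
    by (rule differentiable_cong_open[OF assms(1) Suc.prems that])
  ultimately show ?case
    by (simp add: times_differentiable_on_Suc)
qed simp

lemma times_differentiable_on_diff:
  assumes "open U" "times_differentiable_on n u U" "times_differentiable_on n v U"
  shows "times_differentiable_on n (\<lambda>t. b * u t - v t) U"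
  using assms(2,3)
proof (induction n arbitrary: u v)
  case (Suc n)
  have deriv: "((\<lambda>t. b * u t - v t) has_vector_derivative b * D u t - D v t) (at t)" if "t \<in> U" for t
  proof -
    have "(u has_vector_derivative D u t) (at t)" "(v has_vector_derivative D v t) (at t)"
      using Suc.prems that unfolding times_differentiable_on_Suc D_def vector_derivative_works by auto
    then show ?thesis
      by (intro has_vector_derivative_diff has_vector_derivative_mult_right)
  qed
  have "times_differentiable_on n (\<lambda>t. b * D u t - D v t) U"
    using Suc.prems unfolding times_differentiable_on_Suc by (intro Suc.IH) auto
  then have "times_differentiable_on n (D (\<lambda>t. b * u t - v t)) U"
    using times_differentiable_on_cong[where u="D (\<lambda>t. b * u t - v t)" and v="\<lambda>t. b * D u t - D v t",
        OF assms(1) D_eqI[OF deriv]] by blast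
  then show ?case
    using deriv unfolding times_differentiable_on_Suc by (auto intro: differentiableI_vector)
qed simp

text \<open>Locality of the operator. The relations between the functions below hold only on the
  open set \<open>U\<close>, while \<open>D2_minus\<close> acts on functions on the whole
  line.\<close>

lemma D2_minus_funpow_cong:
  assumes "open U" "\<And>t. t \<in> U \<Longrightarrow> u t = v t" "t \<in> U"
  shows "(D2_minus \<alpha> ^^ n) u t = (D2_minus \<alpha> ^^ n) v t"
  using assms(2,3)
proof (induction n arbitrary: u v t)
  case (Suc n)
  have "D2_minus \<alpha> u s = D2_minus \<alpha> v s" if "s \<in> U" for s
    unfolding D2_minus_def numeral_2_eq_2
    using D_cong[OF assms(1) D_cong[OF assms(1) Suc.prems(1)] that] Suc.prems(1)[OF that] by simp
  then show ?case
    unfolding funpow_Suc_right comp_def by (rule Suc.IH) (assumption, rule Suc.prems(2))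
qed simp

text \<open>An abstract form of the descent in the exponent: \<open>u k\<close> stands for the
  series built from the \<open>k\<close>-th kernel, \<open>u' k\<close> for its derivative, and
  \<open>deriv2\<close> says that \<open>D^2 - \<alpha>^2\<close> maps \<open>u (Suc k)\<close> to
  \<open>- u k\<close> on \<open>U\<close>.\<close>

locale resolvent_chain =
  fixes U :: "real set" and \<alpha> :: real and u u' :: "nat \<Rightarrow> real \<Rightarrow> complex"
  assumes U: "open U"
    and u_0: "\<And>t. u 0 t = 0"
    and deriv: "\<And>k t. t \<in> U \<Longrightarrow> (u (Suc k) has_vector_derivative u' (Suc k) t) (at t)"
    and deriv2: "\<And>k t. t \<in> U \<Longrightarrow>
      (u' (Suc k) has_vector_derivative (of_real (\<alpha>\<^sup>2) * u (Suc k) t - u k t)) (at t)"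
begin

text \<open>A bootstrap: derivatives of members of the chain are again linear combinations of
  members, so each order of differentiability yields the next. For this the induction must treat
  \<open>u\<close> and \<open>u'\<close>, and all \<open>k\<close>, simultaneously.\<close>

lemma times_differentiable: "times_differentiable_on n (u k) U \<and> times_differentiable_on n (u' (Suc k)) U"
proof (induction n arbitrary: k)
  case (Suc n)
  have u: "times_differentiable_on (Suc n) (u k) U" for k
  proof (cases k)
    case 0
    have "times_differentiable_on (Suc n) (\<lambda>t. 0) U" for n
    proof (induction n)
      case (Suc n)
      have "D (\<lambda>t. 0) = (\<lambda>t. 0)"
        by (simp add: D_def fun_eq_iff)
      with Suc show ?case by (simp add: times_differentiable_on_Suc[of "Suc n"])
    qed (simp add: times_differentiable_on_Suc)
    moreover have "u 0 = (\<lambda>t. 0)"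
      by (simp add: u_0 fun_eq_iff)
    ultimately show ?thesis
      by (simp add: 0)
  next
    case (Suc j)
    have "times_differentiable_on n (D (u (Suc j))) U"
      using Suc.IH[of j] times_differentiable_on_cong[where u="D (u (Suc j))" and v="u' (Suc j)", OF U D_eqI[OF deriv]]
      by blast
    then show ?thesis
      unfolding Suc times_differentiable_on_Suc using deriv by (auto intro: differentiableI_vector)
  qed
  have "times_differentiable_on n (D (u' (Suc k))) U"
    using times_differentiable_on_diff[OF U, of n "u (Suc k)" "u k" "of_real (\<alpha>\<^sup>2)"] Suc.IH
      times_differentiable_on_cong[where u="D (u' (Suc k))" and v="\<lambda>t. of_real (\<alpha>\<^sup>2) * u (Suc k) t - u k t",
        OF U D_eqI[OF deriv2]]
    by blast
  then show ?case
    using u[of k] deriv2 unfolding times_differentiable_on_Suc[of n "u' (Suc k)"]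
    by (auto intro: differentiableI_vector)
qed simp

lemma D2_minus_step:
  assumes "t \<in> U"
  shows "D2_minus \<alpha> (\<lambda>t. b * u (Suc k) t) t = - b * u k t"
proof -
  have "D (\<lambda>t. b * u (Suc k) t) s = b * u' (Suc k) s" if "s \<in> U" for s
    by (rule D_eqI[OF has_vector_derivative_mult_right[OF deriv[OF that]]])
  then have "D (D (\<lambda>t. b * u (Suc k) t)) t = D (\<lambda>s. b * u' (Suc k) s) t"
    by (rule D_cong[OF U _ assms])
  also have "\<dots> = b * (of_real (\<alpha>\<^sup>2) * u (Suc k) t - u k t)"
    by (rule D_eqI[OF has_vector_derivative_mult_right[OF deriv2[OF assms]]])
  finally show ?thesis
    by (simp add: D2_minus_def numeral_2_eq_2 algebra_simps)
qed

text \<open>The factor \<open>b\<close> is kept arbitrary to absorb the sign change in each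
  application of the operator.\<close>

lemma D2_minus_funpow: "t \<in> U \<Longrightarrow> (D2_minus \<alpha> ^^ k) (\<lambda>t. b * u k t) t = 0"
proof (induction k arbitrary: b)
  case 0
  then show ?case by (simp add: u_0)
next
  case (Suc k)
  have "(D2_minus \<alpha> ^^ Suc k) (\<lambda>t. b * u (Suc k) t) t = (D2_minus \<alpha> ^^ k) (D2_minus \<alpha> (\<lambda>t. b * u (Suc k) t)) t"
    by (simp add: funpow_Suc_right del: funpow.simps(2))
  also have "\<dots> = (D2_minus \<alpha> ^^ k) (\<lambda>t. - b * u k t) t"
    by (rule D2_minus_funpow_cong[OF U D2_minus_step Suc.prems])
  also have "\<dots> = 0"
    by (rule Suc.IH[OF Suc.prems])
  finally show ?case .
qed

lemma is_solution: "is_solution_on \<alpha> k (u k) U"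
  using times_differentiable D2_minus_funpow[of _ k 1] by (simp add: is_solution_on_def)

end

section \<open>The interpolant as a solution of the differential equation\<close>

locale interpolant = symbol a + translates x \<delta> c
  for a :: real and x :: "nat \<Rightarrow> real" and \<delta> :: real and c :: "nat \<Rightarrow> complex"
begin

lemma decay2_M: "m + 2 \<le> 2 * k \<Longrightarrow> decay2 (M m k)"
  by (rule rapid_decay2[OF rapid_M])

lemma S_M_deriv:
  assumes "m + 3 \<le> 2 * k"
  shows "(S (M m k) has_vector_derivative S (M (Suc m) k) t) (at t)"
  by (rule S_deriv[OF decay2_M decay2_M convex_UNIV open_UNIV]) (use assms M_deriv in auto)

lemma D_funpow_S: "m + 2 \<le> 2 * k \<Longrightarrow> (D ^^ m) (S (M 0 k)) = S (M m k)"
proof (induction m)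
  case (Suc m)
  then have "(D ^^ Suc m) (S (M 0 k)) = D (S (M m k))"
    by simp
  also have "\<dots> = S (M (Suc m) k)"
    using D_eqI[OF S_M_deriv[of m k]] Suc.prems by (simp add: fun_eq_iff)
  finally show ?case .
qed simp

lemma S_M_C0_diff:
  assumes "1 \<le> k"
  shows "S (M 0 k) \<in> C0_diff (2 * k - 2)"
proof -
  have le: "m + 2 \<le> 2 * k" if "m \<le> 2 * k - 2" for m
    using that assms by linarith
  have "times_differentiable_on (2 * k - 2) (S (M 0 k)) UNIV"
    unfolding times_differentiable_on_def
  proof (intro allI impI ballI)
    fix m t assume "m < 2 * k - 2"
    then have "m + 3 \<le> 2 * k" by linarith
    then show "(D ^^ m) (S (M 0 k)) differentiable (at t)"
      using D_funpow_S[of m k] differentiableI_vector[OF S_M_deriv[of m k t]] by simp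
  qed
  moreover have "(D ^^ m) (S (M 0 k)) \<in> C0" if "m \<le> 2 * k - 2" for m
    unfolding D_funpow_S[OF le[OF that]]
    by (rule S_C0[OF decay2_M M_continuous]) (rule le[OF that])+
  ultimately show ?thesis
    by (simp add: C0_diff_def)
qed

lemma S_M_solution:
  assumes "1 \<le> k"
  shows "is_solution_on a k (S (M 0 k)) (UNIV - range x)"
proof -
  \<comment> \<open>Index \<open>0\<close> would correspond to point masses at the nodes, hence
    \<open>0\<close> off them. For index \<open>1\<close> the derivative must be
    \<open>S DM\<close>, since the integral behind \<open>M 1 1\<close> is not absolutely
    convergent.\<close>
  define u where "u k = (if k = 0 then (\<lambda>t. 0) else S (M 0 k))" for k :: nat
  define u' where "u' k = (if k = 1 then S DM else S (M 1 k))" for k :: nat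
  have U: "open (UNIV - range x)"
    using closed_range by (simp add: open_closed Compl_eq_Diff_UNIV[symmetric])
  \<comment> \<open>At exponent \<open>1\<close> the series is differentiated term by term only
    where all translates are smooth at once. The node set is closed, so a whole ball around
    \<open>t\<close> avoids it.\<close>
  have ball: "\<exists>e>0. \<forall>s j. s \<in> ball t e \<longrightarrow> s - x j \<noteq> 0" if t: "t \<in> UNIV - range x" for t
  proof -
    obtain e where e: "0 < e" "ball t e \<subseteq> UNIV - range x"
      using U t unfolding open_contains_ball by blast
    then have "s - x j \<noteq> 0" if "s \<in> ball t e" for s j
      using that by auto
    with e(1) show ?thesis by blast
  qed
  have "resolvent_chain (UNIV - range x) a u u'"
  proof
    fix k t assume t: "t \<in> UNIV - range x"
    then obtain e where e: "0 < e" "\<And>s j. s \<in> ball t e \<Longrightarrow> s - x j \<noteq> 0"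
      using ball by blast
    have in_ball: "t \<in> ball t e"
      using e(1) by simp
    show "(u (Suc k) has_vector_derivative u' (Suc k) t) (at t)"
    proof (cases k)
      case 0
      have "(S (M 0 1) has_vector_derivative S DM t) (at t)"
        by (rule S_deriv[OF decay2_M rapid_decay2[OF rapid_DM] convex_ball open_ball in_ball])
           (use DM_derivs(1)[OF e(2)] in auto)
      then show ?thesis
        by (simp add: u_def u'_def 0)
    next
      case (Suc j)
      have "(S (M 0 (Suc k)) has_vector_derivative S (M 1 (Suc k)) t) (at t)"
        using S_M_deriv[of 0 "Suc k" t] Suc by simp
      then show ?thesis
        by (simp add: u_def u'_def Suc)
    qed
    show "(u' (Suc k) has_vector_derivative (of_real (a\<^sup>2) * u (Suc k) t - u k t)) (at t)"
    proof (cases k)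
      case 0
      have zero: "decay2 (\<lambda>t. 0)"
        unfolding decay2_def by (intro exI[of _ 0]) simp
      have d: "decay2 (\<lambda>t. of_real (a\<^sup>2) * M 0 1 t)"
        by (rule rapid_decay2[OF rapid_scale[OF rapid_M]]) simp
      have "(S DM has_vector_derivative S (\<lambda>t. of_real (a\<^sup>2) * M 0 1 t) t) (at t)"
        by (rule S_deriv[OF rapid_decay2[OF rapid_DM] d convex_ball open_ball in_ball])
           (rule DM_derivs(2)[OF e(2)])
      moreover have "S (\<lambda>t. of_real (a\<^sup>2) * M 0 1 t) t = of_real (a\<^sup>2) * S (M 0 1) t"
        using S_diff[OF decay2_M zero, of 0 1 "of_real (a\<^sup>2)" t] by (simp add: S_def)
      ultimately show ?thesis
        by (simp add: u_def u'_def 0)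
    next
      case (Suc j)
      have "M 2 (Suc k) = (\<lambda>t. of_real (a\<^sup>2) * M 0 (Suc k) t - M 0 k t)"
        using M_2[of k] Suc by auto
      then have "S (M 2 (Suc k)) t = of_real (a\<^sup>2) * S (M 0 (Suc k)) t - S (M 0 k) t"
        using S_diff[OF decay2_M decay2_M, of 0 "Suc k" 0 k "of_real (a\<^sup>2)" t] Suc by simp
      moreover have "(S (M 1 (Suc k)) has_vector_derivative S (M 2 (Suc k)) t) (at t)"
        using S_M_deriv[of 1 "Suc k" t] Suc by (simp add: numeral_2_eq_2)
      ultimately show ?thesis
        by (simp add: u_def u'_def Suc)
    qed
  qed (use U in \<open>simp_all add: u_def\<close>)
  then have "is_solution_on a k (u k) (UNIV - range x)"
    by (rule resolvent_chain.is_solution)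
  then show ?thesis
    using assms by (simp add: u_def)
qed

end

section \<open>Separation of the nodes and the interpolation theorem\<close>

lemma complete_interpolating_sequence_separated:
  assumes "complete_interpolating_sequence x"
  shows "\<exists>\<delta>>0. \<forall>i j. i \<noteq> j \<longrightarrow> \<delta> \<le> \<bar>x i - x j\<bar>"
proof -
  let ?M = "lebesgue_on {-pi..pi}"
  obtain A where A: "0 < A"
    "\<And>J c. finite J \<Longrightarrow> A * (\<Sum>j\<in>J. (norm (c j))\<^sup>2)
      \<le> (L2_norm ?M (\<lambda>t. \<Sum>j\<in>J. c j * exp (\<i> * of_real (x j * t))))\<^sup>2"
    using assms unfolding complete_interpolating_sequence_def Riesz_basis_L2_def by blast
  have *: "A / pi ^ 3 \<le> (x i - x j)\<^sup>2" if ij: "i \<noteq> j" for i j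
  proof -
    \<comment> \<open>The difference of two exponentials has squared norm at least
      \<open>2 * A\<close>. It is bounded pointwise by \<open>\<bar>x i - x j\<bar> * pi\<close> on
      an interval of length \<open>2 * pi\<close>, whence the constant
      \<open>A / pi ^ 3\<close>.\<close>
    define c :: "int \<Rightarrow> complex" where "c l = (if l = i then 1 else -1)" for l
    have "2 * A \<le> (L2_norm ?M (\<lambda>t. \<Sum>l\<in>{i, j}. c l * exp (\<i> * of_real (x l * t))))\<^sup>2"
      using A(2)[of "{i, j}" c] ij by (simp add: c_def)
    also have "\<dots> = (\<integral>t. (norm (cis (x i * t) - cis (x j * t)))\<^sup>2 \<partial>?M)"
      using ij by (simp add: L2_norm_def c_def cis_conv_exp)
    also have "\<dots> \<le> (\<integral>t. (x i - x j)\<^sup>2 * pi\<^sup>2 \<partial>?M)"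
    proof (rule integral_mono')
      show "integrable ?M (\<lambda>t. (x i - x j)\<^sup>2 * pi\<^sup>2)"
        by (simp add: integrable_const_ivl)
      fix t assume "t \<in> space ?M"
      then have t: "\<bar>t\<bar> \<le> pi"
        by auto
      have "norm (cis (x i * t) - cis (x j * t)) \<le> \<bar>x i - x j\<bar> * \<bar>t\<bar>"
        using norm_cis_diff_le[of "x i * t" "x j * t"] by (simp add: abs_mult flip: left_diff_distrib)
      also have "\<dots> \<le> \<bar>x i - x j\<bar> * pi"
        by (intro mult_left_mono t) auto
      finally have "(norm (cis (x i * t) - cis (x j * t)))\<^sup>2 \<le> (\<bar>x i - x j\<bar> * pi)\<^sup>2"
        by (rule power_mono) auto
      then show "(norm (cis (x i * t) - cis (x j * t)))\<^sup>2 \<le> (x i - x j)\<^sup>2 * pi\<^sup>2"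
        by (simp add: power_mult_distrib)
    qed auto
    also have "\<dots> = 2 * (x i - x j)\<^sup>2 * pi ^ 3"
      by (simp add: measure_restrict_space power2_eq_square power3_eq_cube)
    finally show ?thesis
      by (simp add: divide_le_eq)
  qed
  have "sqrt (A / pi ^ 3) \<le> \<bar>x i - x j\<bar>" if "i \<noteq> j" for i j
    using real_sqrt_le_mono[OF *[OF that]] by simp
  moreover have "0 < sqrt (A / pi ^ 3)"
    using A(1) by simp
  ultimately show ?thesis by blast
qed

theorem theorem4:
  fixes \<alpha> :: real and k :: nat and b :: "int \<Rightarrow> complex" and x :: "int \<Rightarrow> real"
  assumes "\<alpha> > 0" and "k \<ge> 1"
    and "l2_seq b"
    and "complete_interpolating_sequence x"
  shows "\<exists>I :: real \<Rightarrow> complex.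
           is_solution_on \<alpha> k I (UNIV - range x) \<and>
           I \<in> C0_diff (2 * k - 2) \<inter> L2_fun lebesgue \<and>
           (\<forall>n. I (x n) = b n)"
proof -
  let ?M = "lebesgue_on {-pi..pi}"
  interpret symbol \<alpha>
    by standard (rule assms)
  \<comment> \<open>Matrices and series above are indexed by natural numbers; nodes and data are
    renumbered along the same bijection, so the interpolation conditions still match.\<close>
  define y where "y n = x (int_decode n)" for n
  define d where "d n = b (int_decode n)" for n
  obtain \<delta> where \<delta>: "0 < \<delta>" "\<And>i j. i \<noteq> j \<Longrightarrow> \<delta> \<le> \<bar>x i - x j\<bar>"
    using complete_interpolating_sequence_separated[OF assms(4)] by blast
  have sep: "\<delta> \<le> \<bar>y i - y j\<bar>" if "i \<noteq> j" for i j
    unfolding y_def using that by (intro \<delta>(2)) (simp add: inj_eq[OF inj_int_decode])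
  have d: "summable (\<lambda>n. (norm (d n))\<^sup>2)"
  proof -
    have "(\<lambda>n. (norm (b n))\<^sup>2) summable_on range int_decode"
      using assms(3) by (simp add: l2_seq_def surj_int_decode)
    then have "(\<lambda>n. (norm (d n))\<^sup>2) summable_on UNIV"
      unfolding d_def by (subst (asm) summable_on_reindex[OF inj_int_decode]) (simp add: comp_def)
    then show ?thesis
      by (rule summable_on_imp_summable)
  qed
  obtain A where A: "0 < A"
    "\<And>J c. finite J \<Longrightarrow> A * (\<Sum>j\<in>J. (norm (c j))\<^sup>2)
      \<le> (L2_norm ?M (\<lambda>t. \<Sum>j\<in>J. c j * exp (\<i> * of_real (x j * t))))\<^sup>2"
    using assms(4) unfolding complete_interpolating_sequence_def Riesz_basis_L2_def by blast
  have Riesz: "A * (\<Sum>j<N. (norm (c j))\<^sup>2)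
      \<le> (L2_norm ?M (\<lambda>t. \<Sum>j<N. cnj (c j) * exp (\<i> * of_real (y j * t))))\<^sup>2" for N c
  proof -
    note inj = inj_int_decode[of "{..<N}"]
    show ?thesis
      using A(2)[of "int_decode ` {..<N}" "\<lambda>j. cnj (c (int_encode j))"]
      by (simp add: sum.reindex[OF inj] y_def)
  qed
  \<comment> \<open>The row sums depend on the nodes alone and are required before the coefficients
    exist; zero coefficients fill the place.\<close>
  interpret T0: translates y \<delta> "\<lambda>_. 0"
    by standard (use \<delta>(1) sep in auto)
  obtain C where C: "0 \<le> C" "\<And>t. norm (M 0 k t) \<le> C / (1 + t\<^sup>2)"
    using rapid_bound[OF rapid_M[of 0 k]] assms(2) by auto
  interpret K: coercive_matrix "\<lambda>i j. M 0 k (y i - y j)" "C * separation_const \<delta>" "(1 / (pi\<^sup>2 + \<alpha>\<^sup>2)) ^ k * A"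
  proof
    show row: "(\<Sum>j<N. norm (M 0 k (y i - y j))) \<le> C * separation_const \<delta>" for i N
      by (rule T0.sum_norm_le_kernel[OF C]) simp
    \<comment> \<open>The kernel is even, so columns have the same absolute sums as rows.\<close>
    show "(\<Sum>i<N. norm (M 0 k (y i - y j))) \<le> C * separation_const \<delta>" for j N
      using row[of j N] M_even[of k "y _ - y j"] by simp
    show "0 < (1 / (pi\<^sup>2 + \<alpha>\<^sup>2)) ^ k * A"
      using A(1) denom_pos[of pi] by simp
    show "(1 / (pi\<^sup>2 + \<alpha>\<^sup>2)) ^ k * A * (\<Sum>i<N. (norm (c i))\<^sup>2)
        \<le> Re (\<Sum>i<N. \<Sum>j<N. cnj (c i) * M 0 k (y i - y j) * c j)" for c N
    proof -
      have "(1 / (pi\<^sup>2 + \<alpha>\<^sup>2)) ^ k * (A * (\<Sum>i<N. (norm (c i))\<^sup>2))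
          \<le> (1 / (pi\<^sup>2 + \<alpha>\<^sup>2)) ^ k * (L2_norm ?M (\<lambda>t. \<Sum>j<N. cnj (c j) * exp (\<i> * of_real (y j * t))))\<^sup>2"
        using denom_pos[of pi] by (intro mult_left_mono Riesz) simp
      also note M_quadratic_form[OF assms(2)]
      finally show ?thesis
        by (simp only: mult.assoc)
    qed
  qed
  obtain c where c: "K.l2 c" "\<And>i. (\<lambda>j. M 0 k (y i - y j) * c j) sums d i"
    using K.solvable[of d] d unfolding K.l2_def by blast
  interpret interpolant \<alpha> y \<delta> c
    by standard (use \<delta>(1) sep c(1) in \<open>auto simp: K.l2_def\<close>)
  have range_y: "range y = range x"
    unfolding y_def[abs_def] using image_image[of x int_decode UNIV] surj_int_decode by simp
  have "S (M 0 k) (x n) = b n" for n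
  proof -
    have "S (M 0 k) (y (int_encode n)) = d (int_encode n)"
      using c(2) unfolding S_def by (simp add: sums_iff)
    then show ?thesis
      by (simp add: y_def d_def)
  qed
  moreover have "S (M 0 k) \<in> L2_fun lebesgue"
    by (rule S_L2[OF decay2_M M_continuous]) (use assms(2) in auto)
  ultimately show ?thesis
    using S_M_solution[OF assms(2)] S_M_C0_diff[OF assms(2)] unfolding range_y by blast
qed

end
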